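(* There exists an absolute constant $K>0$ such that for every $D\in\mathbb{N}$ and every $f\colon\{0,1\}^n\to\{0,1\}$, \[ H\big[\widehat{f^{\leq D}}\big]\leq K\sum_{|S|\leq D}|S|\log(|S|+1)\,\widehat f(S)^2+K\cdot I[f]. \]
   Context: $\{0,1\}^n$ carries the uniform measure; $\chi_S(x)=(-1)^{\sum_{i\in S}x_i}$, $\widehat f(S)=\mathbb{E}_x[f(x)\chi_S(x)]$. $f^{\leq D}=\sum_{|S|\leq D}\widehat f(S)\chi_S$. For $h\colon\{0,1\}^n\to\mathbb{R}$ the Fourier entropy is $H[\widehat h]=\sum_{S\subseteq[n]}\widehat h(S)^2\log(1/\widehat h(S)^2)$ (terms with $\widehat h(S)=0$ are $0$). The total influence is $I[f]=\sum_S|S|\widehat f(S)^2$. $\log$ is the natural logarithm. *)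

theory Defs
  imports Complex_Main "HOL-Library.FuncSet"
begin

text \<open>The coordinate set is \<open>{1..n}\<close>; points of the cube are extensional functions on it, so that
  \<open>n\<close> remains an ordinary natural number that can be quantified over.\<close>

definition cube :: "nat \<Rightarrow> (nat \<Rightarrow> nat) set" where
  "cube n = {1..n} \<rightarrow>\<^sub>E {0, 1}"

definition chi :: "nat set \<Rightarrow> (nat \<Rightarrow> nat) \<Rightarrow> real" where
  "chi S x = (- 1) ^ (\<Sum>i\<in>S. x i)"

definition fourier_coeff :: "nat \<Rightarrow> ((nat \<Rightarrow> nat) \<Rightarrow> real) \<Rightarrow> nat set \<Rightarrow> real" where
  "fourier_coeff n f S = (\<Sum>x\<in>cube n. f x * chi S x) / real (card (cube n))"

definition low_degree_part ::
    "nat \<Rightarrow> nat \<Rightarrow> ((nat \<Rightarrow> nat) \<Rightarrow> real) \<Rightarrow> (nat \<Rightarrow> nat) \<Rightarrow> real" where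
  "low_degree_part n D f x =
    (\<Sum>S | S \<subseteq> {1..n} \<and> card S \<le> D. fourier_coeff n f S * chi S x)"

text \<open>A summand with vanishing coefficient is \<open>0\<close>, because of the factor in front of the
  logarithm.\<close>

definition fourier_entropy :: "nat \<Rightarrow> ((nat \<Rightarrow> nat) \<Rightarrow> real) \<Rightarrow> real" where
  "fourier_entropy n h =
    (\<Sum>S | S \<subseteq> {1..n}. (fourier_coeff n h S)\<^sup>2 * ln (1 / (fourier_coeff n h S)\<^sup>2))"

definition total_influence :: "nat \<Rightarrow> ((nat \<Rightarrow> nat) \<Rightarrow> real) \<Rightarrow> real" where
  "total_influence n f = (\<Sum>S | S \<subseteq> {1..n}. real (card S) * (fourier_coeff n f S)\<^sup>2)"

end

theory Submission imports Defs "HOL-Analysis.Convex" begin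

text \<open>
  Let \<open>\<psi>\<^sub>c(x) = x ln (1 + c / x)\<close>. The stronger estimate
  \<open>\<Sum>\<^bsub>S \<noteq> \<emptyset>\<^esub> \<psi>\<^bsub>c(|S|)\<^esub>(f^(S)\<^sup>2) \<le> K I[f]\<close> with \<open>c(s) = s^(-480 s)\<close> holds for every Boolean \<open>f\<close>; it
  is shown by induction on the set \<open>J\<close> of coordinates, splitting \<open>J = J\<^sub>1 \<union> J\<^sub>2\<close>.

  By Gibbs' inequality the Fourier weight of \<open>U\<^sub>1 \<union> U\<^sub>2\<close> may be coded by the product of the marginal
  weights of \<open>U\<^sub>1\<close> and \<open>U\<^sub>2\<close>. The marginal weight of \<open>U\<^sub>1\<close> is the mean of \<open>g\<^sup>2\<close>, where \<open>g(y)\<close> is the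
  coefficient at \<open>U\<^sub>1\<close> of the restriction of \<open>f\<close> that fixes the coordinates in \<open>J\<^sub>2\<close> to \<open>y\<close>, and
  Bonami's inequality, applied level
    by level, bounds the loss in passing from \<open>\<psi>\<close> of the mean to the
  mean of \<open>\<psi>\<close>. For sets cut into parts of comparable size, the superadditivity of \<open>s ln s\<close> pays for
  this loss; for a random \<open>J\<^sub>1\<close>, unbalanced cuts are exponentially rare. What remains is a constant
  for each set meeting both halves, and a set \<open>S\<close> is cut only \<open>|S| - 1\<close> times until it consists of
  singletons, so the total error is \<open>O(I[f])\<close>.

  That \<open>f\<close> is Boolean enters twice: on a single coordinate the coefficient is \<open>0\<close> or \<open>\<plusminus>1/2\<close>, and the
  product of the variances in the two directions is controlled by the weight of the sets that meet
  both halves.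
\<close>

section \<open>Averages and Walsh sums\<close>

definition avg :: "'b set \<Rightarrow> ('b \<Rightarrow> real) \<Rightarrow> real" where
  "avg A g = (\<Sum>x\<in>A. g x) / real (card A)"

lemma avg_const [simp]: "finite A \<Longrightarrow> A \<noteq> {} \<Longrightarrow> avg A (\<lambda>_. c) = c"
  by (simp add: avg_def)

lemma avg_Pow_const [simp]: "finite J \<Longrightarrow> avg (Pow J) (\<lambda>_. c) = c"
  by (rule avg_const) auto

lemma avg_add: "avg A (\<lambda>x. g x + h x) = avg A g + avg A h"
  by (simp add: avg_def sum.distrib add_divide_distrib)

lemma avg_diff: "avg A (\<lambda>x. g x - h x) = avg A g - avg A h"
  by (simp add: avg_def sum_subtractf diff_divide_distrib)

lemma avg_mult_left: "avg A (\<lambda>x. c * g x) = c * avg A g"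
  by (simp add: avg_def sum_distrib_left)

lemma avg_mult_right: "avg A (\<lambda>x. g x * c) = avg A g * c"
  by (simp add: avg_def sum_distrib_right)

lemma avg_divide: "avg A (\<lambda>x. g x / c) = avg A g / c"
  by (simp add: avg_def sum_divide_distrib[symmetric] mult.commute)

lemma avg_sum: "avg A (\<lambda>x. \<Sum>i\<in>I. g i x) = (\<Sum>i\<in>I. avg A (g i))"
  unfolding avg_def by (subst sum.swap) (simp add: sum_divide_distrib)

lemma avg_mono: "(\<And>x. x \<in> A \<Longrightarrow> g x \<le> h x) \<Longrightarrow> avg A g \<le> avg A h"
  by (simp add: avg_def sum_mono divide_right_mono)

lemma avg_cong: "(\<And>x. x \<in> A \<Longrightarrow> g x = h x) \<Longrightarrow> avg A g = avg A h"
  by (simp add: avg_def)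

text \<open>As a congruence rule this lets the simplifier use \<open>x \<in> A\<close> while it
  rewrites the averaged function.\<close>

lemma avg_cong_simp: "(\<And>x. x \<in> A =simp=> g x = h x) \<Longrightarrow> avg A g = avg A h"
  unfolding simp_implies_def by (rule avg_cong)

lemma avg_nonneg: "(\<And>x. x \<in> A \<Longrightarrow> 0 \<le> g x) \<Longrightarrow> 0 \<le> avg A g"
  by (simp add: avg_def sum_nonneg)

lemma sum_Pow_Un:
  fixes \<phi> :: "'a set \<Rightarrow> 'b::comm_monoid_add"
  assumes "A \<inter> B = {}"
  shows "(\<Sum>U\<in>Pow (A \<union> B). \<phi> U) = (\<Sum>V\<in>Pow A. \<Sum>W\<in>Pow B. \<phi> (V \<union> W))"
proof -
  have "(\<Sum>V\<in>Pow A. \<Sum>W\<in>Pow B. \<phi> (V \<union> W)) = (\<Sum>(V, W)\<in>Pow A \<times> Pow B. \<phi> (V \<union> W))"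
    by (simp add: sum.cartesian_product)
  also have "\<dots> = (\<Sum>U\<in>Pow (A \<union> B). \<phi> U)"
    by (rule sum.reindex_bij_witness[where j = "\<lambda>(V, W). V \<union> W" and i = "\<lambda>U. (U \<inter> A, U \<inter> B)"])
      (use assms in auto)
  finally show ?thesis by simp
qed

lemma sum_Pow_insert:
  fixes \<phi> :: "'a set \<Rightarrow> 'b::comm_monoid_add"
  assumes "finite J" "i \<notin> J"
  shows "(\<Sum>U\<in>Pow (insert i J). \<phi> U) = (\<Sum>U\<in>Pow J. \<phi> U) + (\<Sum>U\<in>Pow J. \<phi> (insert i U))"
proof -
  have "inj_on (insert i) (Pow J)"
    using assms by (intro inj_onI) (auto simp: insert_ident)
  moreover have "Pow J \<inter> insert i ` Pow J = {}"
    using assms by auto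
  ultimately show ?thesis
    using assms by (simp add: Pow_insert sum.union_disjoint sum.reindex)
qed

lemma avg_Pow_insert:
  assumes "finite J" "i \<notin> J"
  shows "avg (Pow (insert i J)) g = (avg (Pow J) g + avg (Pow J) (\<lambda>Y. g (insert i Y))) / 2"
  using assms by (simp add: avg_def sum_Pow_insert card_Pow field_simps)

lemma avg_swap: "avg A (\<lambda>x. avg B (\<lambda>y. g x y)) = avg B (\<lambda>y. avg A (\<lambda>x. g x y))"
proof -
  have "(\<Sum>x\<in>A. \<Sum>y\<in>B. g x y) = (\<Sum>y\<in>B. \<Sum>x\<in>A. g x y)" by (rule sum.swap)
  then show ?thesis by (simp add: avg_def sum_divide_distrib[symmetric] mult.commute)
qed

text \<open>Expanding \<open>(x + y) ^ card U\<close> decides for every element of \<open>U\<close>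
  whether it lies in \<open>V\<close>; each element of \<open>J - U\<close> is free and contributes
  a factor 2. Averages over random cuts are computed this way.\<close>

lemma sum_Pow_power_card:
  fixes x y :: real
  assumes "finite J" "U \<subseteq> J"
  shows "(\<Sum>V\<in>Pow J. x ^ card (U \<inter> V) * y ^ card (U - V)) = 2 ^ card (J - U) * (x + y) ^ card U"
  using assms
proof (induction J arbitrary: U rule: finite_induct)
  case empty
  then show ?case by simp
next
  case (insert i J)
  show ?case
  proof (cases "i \<in> U")
    case True
    define U' where "U' = U - {i}"
    have U: "U = insert i U'" "i \<notin> U'" "U' \<subseteq> J" "finite U'"
      using insert.prems insert.hyps True by (auto simp: U'_def intro: finite_subset)
    have *: "insert i U' \<inter> V = U' \<inter> V" "insert i U' - V = insert i (U' - V)"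
       "insert i U' \<inter> insert i V = insert i (U' \<inter> V)" "insert i U' - insert i V = U' - V"
      if "V \<in> Pow J" for V
      using that insert.hyps U by auto
    have "insert i J - insert i U' = J - U'" using insert.hyps by auto
    moreover have "i \<notin> U' \<inter> V" "i \<notin> U' - V" for V using U by auto
    ultimately show ?thesis
      using insert.hyps U insert.IH[OF U(3)]
      by (simp add: sum_Pow_insert * mult_ac cong: sum.cong_simp)
        (simp add: sum_distrib_left[symmetric] algebra_simps)
  next
    case False
    then have U: "U \<subseteq> J" using insert.prems by auto
    have *: "U \<inter> insert i V = U \<inter> V" "U - insert i V = U - V" for V
      using False by auto
    have "insert i J - U = insert i (J - U)" using False by auto
    then show ?thesis
      using insert.hyps insert.IH[OF U] by (simp add: sum_Pow_insert *)
  qed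
qed

section \<open>Walsh functions and Parseval's identity\<close>

definition walsh :: "'a set \<Rightarrow> 'a set \<Rightarrow> real" where
  "walsh U Y = (- 1) ^ card (U \<inter> Y)"

text \<open>A point of the cube is encoded as the set \<open>Y\<close> of coordinates where it
  equals 1, so \<open>walsh_sum J b\<close> is the function on the cube with Fourier coefficients
  \<open>b\<close>.\<close>

definition walsh_sum :: "'a set \<Rightarrow> ('a set \<Rightarrow> real) \<Rightarrow> 'a set \<Rightarrow> real" where
  "walsh_sum J b Y = (\<Sum>U\<in>Pow J. b U * walsh U Y)"

lemma walsh_commute: "walsh U Y = walsh Y U"
  by (simp add: walsh_def Int_commute)

lemma walsh_empty [simp]: "walsh {} Y = 1"
  by (simp add: walsh_def)

lemma walsh_Un:
  assumes "finite A" "finite B" "A \<inter> B = {}" "U \<subseteq> A" "V \<subseteq> B" "Y \<subseteq> A" "Z \<subseteq> B"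
  shows "walsh (U \<union> V) (Y \<union> Z) = walsh U Y * walsh V Z"
proof -
  have "(U \<union> V) \<inter> (Y \<union> Z) = (U \<inter> Y) \<union> (V \<inter> Z)" "(U \<inter> Y) \<inter> (V \<inter> Z) = {}"
    using assms by blast+
  moreover have "finite (U \<inter> Y)" "finite (V \<inter> Z)"
    using assms by (auto intro: finite_subset)
  ultimately show ?thesis
    by (simp add: walsh_def card_Un_disjoint power_add)
qed

text \<open>Characters factor over disjoint coordinate sets. The inner sum is the coefficient at
  \<open>U\<close> of the restriction that fixes the coordinates in \<open>B\<close> to
  \<open>Z\<close>.\<close>

lemma walsh_sum_Un:
  assumes "finite A" "finite B" "A \<inter> B = {}" "Y \<subseteq> A" "Z \<subseteq> B"
  shows "walsh_sum (A \<union> B) a (Y \<union> Z) = walsh_sum A (\<lambda>U. walsh_sum B (\<lambda>V. a (U \<union> V)) Z) Y"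
  using assms
  by (simp add: walsh_sum_def sum_Pow_Un walsh_Un[where A=A and B=B] sum_distrib_right sum_distrib_left mult_ac cong: sum.cong_simp)

lemma walsh_sum_insert:
  assumes "finite J" "i \<notin> J" "Y \<subseteq> J"
  shows "walsh_sum (insert i J) b Y = walsh_sum J b Y + walsh_sum J (\<lambda>V. b (insert i V)) Y"
    and "walsh_sum (insert i J) b (insert i Y)
        = walsh_sum J b Y - walsh_sum J (\<lambda>V. b (insert i V)) Y"
proof -
  have "insert i V \<inter> Y = V \<inter> Y" "V \<inter> insert i Y = V \<inter> Y"
    "card (insert i V \<inter> insert i Y) = Suc (card (V \<inter> Y))" if "V \<in> Pow J" for V
  proof -
    show "insert i V \<inter> Y = V \<inter> Y" "V \<inter> insert i Y = V \<inter> Y" using assms that by auto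
    have "insert i V \<inter> insert i Y = insert i (V \<inter> Y)" "finite (V \<inter> Y)" "i \<notin> V \<inter> Y"
      using assms that by (auto intro: finite_subset)
    then show "card (insert i V \<inter> insert i Y) = Suc (card (V \<inter> Y))" by simp
  qed
  then show "walsh_sum (insert i J) b Y = walsh_sum J b Y + walsh_sum J (\<lambda>V. b (insert i V)) Y"
    and "walsh_sum (insert i J) b (insert i Y)
        = walsh_sum J b Y - walsh_sum J (\<lambda>V. b (insert i V)) Y"
    using assms
      by (simp_all add: walsh_sum_def sum_Pow_insert walsh_def sum_negf cong: sum.cong_simp)
qed

lemma avg_walsh_sum:
  assumes "finite J"
  shows "avg (Pow J) (walsh_sum J b) = b {}"
  using assms
proof (induction J arbitrary: b rule: finite_induct)
  case empty
  then show ?case by (simp add: avg_def walsh_sum_def)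
next
  case (insert i J)
  then show ?case
    by (simp add: avg_Pow_insert walsh_sum_insert avg_add avg_diff cong: avg_cong_simp)
qed

lemma parseval:
  assumes "finite J"
  shows "avg (Pow J) (\<lambda>Y. (walsh_sum J b Y)\<^sup>2) = (\<Sum>V\<in>Pow J. (b V)\<^sup>2)"
  using assms
proof (induction J arbitrary: b rule: finite_induct)
  case empty
  then show ?case by (simp add: avg_def walsh_sum_def)
next
  case (insert i J)
  \<comment> \<open>The cross terms cancel when the two values of coordinate \<open>i\<close> are
    averaged.\<close>
  have "(x + y)\<^sup>2 = x\<^sup>2 + y\<^sup>2 + 2 * x * y" "(x - y)\<^sup>2 = x\<^sup>2 + y\<^sup>2 - 2 * x * y" for x y :: real
    by (simp_all add: power2_eq_square algebra_simps)
  with insert show ?case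
    by (simp add: avg_Pow_insert walsh_sum_insert avg_add avg_diff sum_Pow_insert cong: avg_cong_simp)
qed

section \<open>Hypercontractivity: fourth moments of Walsh sums\<close>

lemma avg_mult_le:
  assumes "avg A (\<lambda>x. (g x)\<^sup>2) \<le> a\<^sup>2" "avg A (\<lambda>x. (h x)\<^sup>2) \<le> b\<^sup>2" "0 \<le> a" "0 \<le> b"
    "\<And>x. x \<in> A \<Longrightarrow> 0 \<le> g x" "\<And>x. x \<in> A \<Longrightarrow> 0 \<le> h x"
  shows "avg A (\<lambda>x. g x * h x) \<le> a * b"
proof (rule power2_le_imp_le)
  have "(\<Sum>x\<in>A. g x * h x)\<^sup>2 \<le> (\<Sum>x\<in>A. (g x)\<^sup>2) * (\<Sum>x\<in>A. (h x)\<^sup>2)"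
    by (rule Cauchy_Schwarz_ineq_sum)
  then have "(avg A (\<lambda>x. g x * h x))\<^sup>2 \<le> avg A (\<lambda>x. (g x)\<^sup>2) * avg A (\<lambda>x. (h x)\<^sup>2)"
    by (simp add: avg_def power_divide power2_eq_square divide_right_mono)
  also have "\<dots> \<le> a\<^sup>2 * b\<^sup>2"
    using assms by (intro mult_mono) (auto intro!: avg_nonneg)
  finally show "(avg A (\<lambda>x. g x * h x))\<^sup>2 \<le> (a * b)\<^sup>2"
    by (simp add: power_mult_distrib)
qed (use assms in auto)

text \<open>Averaging over a new coordinate removes the odd powers of \<open>H\<close> and leaves
  \<open>G^4 + 6 G^2 H^2 + H^4\<close>. The factor 3 per coordinate makes the middle term, at most
  \<open>6 A B\<close> by Cauchy-Schwarz, fit into \<open>(A + 3 B)^2\<close>.\<close>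

lemma bonami:
  assumes "finite J"
  shows "avg (Pow J) (\<lambda>Y. (walsh_sum J b Y) ^ 4) \<le> (\<Sum>V\<in>Pow J. 3 ^ card V * (b V)\<^sup>2)\<^sup>2"
  using assms
proof (induction J arbitrary: b rule: finite_induct)
  case empty
  then show ?case by (simp add: avg_def walsh_sum_def power2_eq_square power4_eq_xxxx)
next
  case (insert i J)
  let ?h = "\<lambda>V. b (insert i V)"
  define G where "G = walsh_sum J b"
  define H where "H = walsh_sum J ?h"
  define A where "A = (\<Sum>V\<in>Pow J. 3 ^ card V * (b V)\<^sup>2)"
  define B where "B = (\<Sum>V\<in>Pow J. 3 ^ card V * (?h V)\<^sup>2)"
  have AB: "0 \<le> A" "0 \<le> B" by (simp_all add: A_def B_def sum_nonneg)
  have G: "avg (Pow J) (\<lambda>Y. (G Y) ^ 4) \<le> A\<^sup>2" and H: "avg (Pow J) (\<lambda>Y. (H Y) ^ 4) \<le> B\<^sup>2"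
    unfolding G_def H_def A_def B_def by (rule insert.IH)+
  have GH: "avg (Pow J) (\<lambda>Y. (G Y)\<^sup>2 * (H Y)\<^sup>2) \<le> A * B"
    by (rule avg_mult_le) (use G H AB in \<open>simp_all flip: power_mult\<close>)
  have "card (insert i V) = Suc (card V)" if "V \<in> Pow J" for V
    using that insert.hyps by (subst card_insert_disjoint) (auto intro: finite_subset)
  then have S: "(\<Sum>V\<in>Pow (insert i J). 3 ^ card V * (b V)\<^sup>2) = A + 3 * B"
    using insert.hyps
      by (simp add: sum_Pow_insert A_def B_def sum_distrib_left mult.assoc cong: sum.cong_simp)
  have "avg (Pow (insert i J)) (\<lambda>Y. (walsh_sum (insert i J) b Y) ^ 4) =
      avg (Pow J) (\<lambda>Y. ((G Y + H Y) ^ 4 + (G Y - H Y) ^ 4) / 2)"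
    using insert.hyps
    by (simp add: avg_Pow_insert walsh_sum_insert G_def H_def avg_add add_divide_distrib avg_divide cong: avg_cong_simp)
  also have "\<dots> = avg (Pow J) (\<lambda>Y. (G Y) ^ 4 + 6 * ((G Y)\<^sup>2 * (H Y)\<^sup>2) + (H Y) ^ 4)"
    by (intro avg_cong) (simp add: power2_eq_square power4_eq_xxxx algebra_simps)
  also have "\<dots> \<le> A\<^sup>2 + 6 * (A * B) + B\<^sup>2"
    using G H GH by (simp add: avg_add avg_mult_left)
  also have "\<dots> \<le> (A + 3 * B)\<^sup>2"
    using AB by (simp add: power2_eq_square algebra_simps)
  finally show ?case by (simp only: S)
qed

text \<open>All terms have degree \<open>k\<close>, so the weight \<open>3 ^ k\<close> leaves the
  square as \<open>9 ^ k\<close>.\<close>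

lemma bonami_level:
  assumes "finite J" "\<And>V. V \<subseteq> J \<Longrightarrow> card V \<noteq> k \<Longrightarrow> b V = 0"
  shows "avg (Pow J) (\<lambda>Y. (walsh_sum J b Y) ^ 4) \<le> 9 ^ k * (\<Sum>V\<in>Pow J. (b V)\<^sup>2)\<^sup>2"
proof -
  have "(\<Sum>V\<in>Pow J. 3 ^ card V * (b V)\<^sup>2) = (\<Sum>V\<in>Pow J. 3 ^ k * (b V)\<^sup>2)"
    using assms by (intro sum.cong) auto
  then have "(\<Sum>V\<in>Pow J. 3 ^ card V * (b V)\<^sup>2)\<^sup>2 = (3 ^ k)\<^sup>2 * (\<Sum>V\<in>Pow J. (b V)\<^sup>2)\<^sup>2"
    by (simp add: sum_distrib_left[symmetric] power_mult_distrib)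
  also have "(3 ^ k)\<^sup>2 = (9::real) ^ k"
    by (simp add: power2_eq_square power_mult_distrib[symmetric])
  finally show ?thesis using bonami[OF assms(1), of b] by simp
qed

section \<open>Averages of psi over restrictions\<close>

text \<open>For \<open>c > 0\<close> and \<open>x > 0\<close> this is a nonnegative majorant of
  \<open>x * ln (c / x)\<close>, which itself may be negative. It vanishes at
  \<open>x = 0\<close>.\<close>

definition psi :: "real \<Rightarrow> real \<Rightarrow> real" where
  "psi c x = x * ln (1 + c / x)"

lemma ln_one_plus_div_antimono:
  fixes c x y :: real
  assumes "0 < c" "0 < x" "x \<le> y"
  shows "ln (1 + c / y) \<le> ln (1 + c / x)"
proof -
  have "c / y \<le> c / x" using assms by (intro divide_left_mono) auto
  moreover have "0 < c / y" using assms by auto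
  ultimately show ?thesis by (subst ln_le_cancel_iff) linarith+
qed

text \<open>The correction is quadratic in \<open>d\<close>, so no error is left where \<open>d\<close> vanishes, and the linear term
  averages out.\<close>

lemma psi_square_tangent:
  fixes c \<alpha> :: real
  assumes "0 < c"
  shows "\<exists>s. \<forall>d. psi c (\<alpha>\<^sup>2) + s * d + d\<^sup>2 * ln (1 + c / (\<bar>\<alpha>\<bar> + \<bar>d\<bar>)\<^sup>2) - 12 * d\<^sup>2
      \<le> psi c ((\<alpha> + d)\<^sup>2)"
proof (cases "\<alpha> = 0")
  case True
  then show ?thesis by (intro exI[of _ 0]) (simp add: psi_def)
next
  case False
  define P where "P = \<alpha>\<^sup>2"
  define l where "l = ln (1 + c / P)"
  have P: "0 < P" using False by (simp add: P_def)
  \<comment> \<open>The slope is the derivative of \<open>psi c ((\<alpha> + d)\<^sup>2)\<close>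
    with respect to \<open>d\<close> at \<open>d = 0\<close>.\<close>
  have goal: "psi c (\<alpha>\<^sup>2) + (2 * \<alpha> * l - 2 * c * \<alpha> / (P + c)) * d + d\<^sup>2 * ln (1 + c / (\<bar>\<alpha>\<bar> + \<bar>d\<bar>)\<^sup>2)
      - 12 * d\<^sup>2
      \<le> psi c ((\<alpha> + d)\<^sup>2)" for d
  proof -
    define X where "X = (\<alpha> + d)\<^sup>2"
    define M where "M = (\<bar>\<alpha>\<bar> + \<bar>d\<bar>)\<^sup>2"
    define lM where "lM = ln (1 + c / M)"
    have X0: "0 \<le> X" by (simp add: X_def)
    have XP: "X = P + 2 * \<alpha> * d + d\<^sup>2" by (simp add: X_def P_def power2_eq_square algebra_simps)
    have "P = \<bar>\<alpha>\<bar>\<^sup>2" by (simp add: P_def)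
    also have "\<dots> \<le> M" unfolding M_def by (rule power_mono) auto
    finally have PM: "P \<le> M" .
    have "X = \<bar>\<alpha> + d\<bar>\<^sup>2" by (simp add: X_def)
    also have "\<dots> \<le> M" unfolding M_def by (rule power_mono) auto
    finally have XM: "X \<le> M" .
    have lM: "lM \<le> l" unfolding lM_def l_def using assms P PM by (rule ln_one_plus_div_antimono)
    \<comment> \<open>The terms common to both sides are cancelled. For \<open>d\<close> small
      against \<alpha> the logarithm is linearised; for \<open>d\<close> large each error is by
      itself of order \<open>d^2\<close>.\<close>
    have key: "- 12 * d\<^sup>2 \<le> X * ln (1 + c / X) - X * l + d\<^sup>2 * (l - lM) + 2 * c * \<alpha> * d / (P + c)"
    proof (cases "\<bar>d\<bar> \<le> \<bar>\<alpha>\<bar> / 2")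
      case True
      then have "\<alpha> + d \<noteq> 0" using False by auto
      then have X: "0 < X" by (simp add: X_def)
      define T where "T = X * c / ((X + c) * P)"
      have "\<bar>\<alpha> + d\<bar> \<le> 3 / 2 * \<bar>\<alpha>\<bar>" using True abs_triangle_ineq[of \<alpha> d] by simp
      then have "\<bar>\<alpha> + d\<bar>\<^sup>2 \<le> (3 / 2 * \<bar>\<alpha>\<bar>)\<^sup>2" by (intro power_mono) auto
      then have X94: "X \<le> 9 / 4 * P" by (simp add: X_def P_def power_mult_distrib power2_eq_square)
      have "T = c / (X + c) * (X / P)" by (simp add: T_def)
      also have "\<dots> \<le> 1 * (9 / 4)" using X94 X P assms by (intro mult_mono) (auto simp: field_simps)
      finally have T: "T \<le> 9 / 4" by simp
      have pos: "0 < (X + c) * P" "0 < X * (P + c)" using X P assms by auto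
      have "X * (ln (1 + c / X) - l) = X * ln (((X + c) * P) / (X * (P + c)))"
      proof -
        have "1 + c / X = (X + c) / X" "1 + c / P = (P + c) / P" using X P
          by (auto simp: field_simps)
        then show ?thesis using X P assms by (simp add: l_def ln_div ln_mult)
      qed
      also have "\<dots> \<ge> X * (1 - X * (P + c) / ((X + c) * P))"
      proof -
        define y where "y = X * (P + c) / ((X + c) * P)"
        have y: "0 < y" using pos by (simp add: y_def)
        have "((X + c) * P) / (X * (P + c)) = 1 / y" by (simp add: y_def)
        moreover have "ln (1 / y) = - ln y" using y by (simp add: ln_div)
        moreover have "ln y \<le> y - 1" using y by (rule ln_le_minus_one)
        ultimately show ?thesis using X unfolding y_def[symmetric] by (intro mult_left_mono) auto
      qed
      also have "X * (1 - X * (P + c) / ((X + c) * P)) = T * (P - X)"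
      proof -
        have "1 - X * (P + c) / ((X + c) * P) = c * (P - X) / ((X + c) * P)"
          using X P assms by (simp add: divide_simps) (simp add: algebra_simps)
        then show ?thesis by (simp add: T_def)
      qed
      finally have 1: "T * (P - X) \<le> X * (ln (1 + c / X) - l)" .
      \<comment> \<open>\<open>T\<close> agrees with the factor \<open>c / (P + c)\<close> of the
        slope up to first order in \<open>P - X\<close>, which is itself of first order in
        \<open>d\<close>. Multiplied by \<open>\<alpha> * d\<close> the mismatch is quadratic in
        \<open>d\<close>.\<close>
      have "c / (P + c) - T = c\<^sup>2 * (P - X) / ((P + c) * ((X + c) * P))"
        using X P assms unfolding T_def
        by (simp add: divide_simps) (simp add: power2_eq_square algebra_simps)
      then have "\<bar>2 * \<alpha> * d * (c / (P + c) - T)\<bar>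
          = (2 * \<bar>\<alpha>\<bar> * \<bar>d\<bar> * \<bar>P - X\<bar> / P) * (c / (P + c) * (c / (X + c)))"
        using X P assms by (simp add: abs_mult power2_eq_square) (simp add: mult_ac)
      also have "\<dots> \<le> (5 * d\<^sup>2) * 1"
      proof (intro mult_mono)
        have "P - X = - (d * (2 * \<alpha> + d))"
          unfolding XP by (simp add: power2_eq_square algebra_simps)
        then have "\<bar>P - X\<bar> = \<bar>d\<bar> * \<bar>2 * \<alpha> + d\<bar>"
          by (simp only: abs_minus_cancel abs_mult)
        also have "\<dots> \<le> \<bar>d\<bar> * (5 / 2 * \<bar>\<alpha>\<bar>)"
          using True abs_triangle_ineq[of "2 * \<alpha>" d]
            by (intro mult_left_mono) (simp_all add: abs_mult)
        finally have "2 * \<bar>\<alpha>\<bar> * \<bar>d\<bar> * \<bar>P - X\<bar> \<le> 2 * \<bar>\<alpha>\<bar> * \<bar>d\<bar> * (\<bar>d\<bar> * (5 / 2 * \<bar>\<alpha>\<bar>))"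
          by (intro mult_left_mono) auto
        also have "\<dots> = 5 * d\<^sup>2 * P"
        proof -
          have "\<bar>d\<bar> * \<bar>d\<bar> = d\<^sup>2" "\<bar>\<alpha>\<bar> * \<bar>\<alpha>\<bar> = P" by (simp_all add: P_def power2_eq_square)
          moreover have "2 * \<bar>\<alpha>\<bar> * \<bar>d\<bar> * (\<bar>d\<bar> * (5 / 2 * \<bar>\<alpha>\<bar>)) = 5 * (\<bar>d\<bar> * \<bar>d\<bar>) * (\<bar>\<alpha>\<bar> * \<bar>\<alpha>\<bar>)"
            by (simp add: mult_ac)
          ultimately show ?thesis by simp
        qed
        finally show "2 * \<bar>\<alpha>\<bar> * \<bar>d\<bar> * \<bar>P - X\<bar> / P \<le> 5 * d\<^sup>2" using P by (simp add: field_simps)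
        have "c / (P + c) \<le> 1" "c / (X + c) \<le> 1" using P X assms by auto
        then show "c / (P + c) * (c / (X + c)) \<le> 1"
          using P X assms by (intro mult_le_one) auto
      qed (use X P assms in auto)
      finally have 2: "- 5 * d\<^sup>2 \<le> 2 * \<alpha> * d * (c / (P + c) - T)" by (simp add: abs_le_iff)
      have 3: "d\<^sup>2 * T \<le> d\<^sup>2 * (9 / 4)" using T by (intro mult_left_mono) auto
      have 4: "0 \<le> d\<^sup>2 * (l - lM)" using lM by simp
      have "T * (P - X) + 2 * c * \<alpha> * d / (P + c) = 2 * \<alpha> * d * (c / (P + c) - T) - d\<^sup>2 * T"
        unfolding XP by (simp add: algebra_simps)
      moreover have "X * (ln (1 + c / X) - l) = X * ln (1 + c / X) - X * l"
        by (rule right_diff_distrib)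
      ultimately show ?thesis using 1 2 3 4 zero_le_power2[of d] by linarith
    next
      case False
      then have d: "\<bar>\<alpha>\<bar> \<le> 2 * \<bar>d\<bar>" by simp
      have aa: "\<bar>\<alpha>\<bar> * \<bar>d\<bar> \<le> 2 * d\<^sup>2"
        using mult_right_mono[OF d, of "\<bar>d\<bar>"] by (simp add: power2_eq_square mult.assoc)
      have 1: "X * lM \<le> X * ln (1 + c / X)"
      proof (cases "X = 0")
        case False
        then show ?thesis unfolding lM_def using X0 XM assms
          by (intro mult_left_mono ln_one_plus_div_antimono) auto
      qed simp
      \<comment> \<open>The quotient of the arguments of the two logarithms is at most
        \<open>M / P\<close>, whatever \<open>c\<close> is.\<close>
      have "l - lM \<le> 2 * (\<bar>d\<bar> / \<bar>\<alpha>\<bar>)"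
      proof -
        have M: "0 < M" using P PM by simp
        have "0 < 1 + c / P" "0 < 1 + c / M" using assms P M by (simp_all add: add_pos_pos)
        then have "l - lM = ln ((1 + c / P) / (1 + c / M))"
          by (simp add: l_def lM_def ln_div)
        also have "\<dots> \<le> ln (M / P)"
        proof -
          have "(1 + c / P) / (1 + c / M) = (M / P) * ((P + c) / (M + c))"
            using assms P M by (simp add: field_simps)
          also have "\<dots> \<le> (M / P) * 1" using assms P M PM by (intro mult_left_mono) auto
          finally show ?thesis using assms P M
            by (subst ln_le_cancel_iff) (auto intro!: divide_pos_pos add_pos_pos)
        qed
        also have "M / P = (1 + \<bar>d\<bar> / \<bar>\<alpha>\<bar>)\<^sup>2"
          using \<open>\<alpha> \<noteq> 0\<close> by (simp add: M_def P_def power2_eq_square field_simps)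
        also have "ln \<dots> = 2 * ln (1 + \<bar>d\<bar> / \<bar>\<alpha>\<bar>)"
          by (subst ln_realpow) (auto intro!: add_pos_nonneg)
        also have "\<dots> \<le> 2 * (\<bar>d\<bar> / \<bar>\<alpha>\<bar>)"
          by (intro mult_left_mono ln_add_one_self_le_self) auto
        finally show ?thesis .
      qed
      then have "(P + 2 * \<bar>\<alpha>\<bar> * \<bar>d\<bar>) * (l - lM) \<le> (P + 2 * \<bar>\<alpha>\<bar> * \<bar>d\<bar>) * (2 * (\<bar>d\<bar> / \<bar>\<alpha>\<bar>))"
        using P by (intro mult_left_mono) auto
      also have "\<dots> = 2 * (\<bar>\<alpha>\<bar> * \<bar>d\<bar>) + 4 * d\<^sup>2"
      proof -
        have "(x\<^sup>2 + 2 * x * y) * (2 * (y / x)) = 2 * (x * y) + 4 * y\<^sup>2" if "x \<noteq> 0" for x y :: real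
          using that by (simp add: field_simps power2_eq_square)
        from this[of "\<bar>\<alpha>\<bar>" "\<bar>d\<bar>"] show ?thesis using \<open>\<alpha> \<noteq> 0\<close> by (simp add: P_def)
      qed
      finally have 2: "(P + 2 * \<bar>\<alpha>\<bar> * \<bar>d\<bar>) * (l - lM) \<le> 8 * d\<^sup>2" using aa by simp
      have "(P + 2 * \<alpha> * d) * (l - lM) \<le> (P + 2 * \<bar>\<alpha>\<bar> * \<bar>d\<bar>) * (l - lM)"
      proof (intro mult_right_mono)
        have "\<alpha> * d \<le> \<bar>\<alpha>\<bar> * \<bar>d\<bar>" by (metis abs_ge_self abs_mult)
        then show "P + 2 * \<alpha> * d \<le> P + 2 * \<bar>\<alpha>\<bar> * \<bar>d\<bar>" by simp
      qed (use lM in simp)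
      then have 3: "- 8 * d\<^sup>2 \<le> (d\<^sup>2 - X) * (l - lM)" using 2 unfolding XP
        by (simp add: algebra_simps)
      have "\<bar>2 * c * \<alpha> * d / (P + c)\<bar> = c / (P + c) * (2 * (\<bar>\<alpha>\<bar> * \<bar>d\<bar>))"
        using P assms by (simp add: abs_mult)
      also have "\<dots> \<le> 1 * (4 * d\<^sup>2)"
        by (rule mult_mono) (use P assms aa in auto)
      finally have "- (2 * c * \<alpha> * d / (P + c)) \<le> 1 * (4 * d\<^sup>2)" by (rule abs_le_D2)
      then have 4: "- 4 * d\<^sup>2 \<le> 2 * c * \<alpha> * d / (P + c)" by simp
      have "X * ln (1 + c / X) - X * l + d\<^sup>2 * (l - lM)
          = (X * ln (1 + c / X) - X * lM) + (d\<^sup>2 - X) * (l - lM)"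
        by (simp add: algebra_simps)
      then show ?thesis using 1 3 4 by linarith
    qed
    have "psi c (\<alpha>\<^sup>2) = P * l" "psi c ((\<alpha> + d)\<^sup>2) = X * ln (1 + c / X)"
      by (simp_all add: psi_def P_def l_def X_def)
    moreover have "X * l = P * l + 2 * \<alpha> * d * l + d\<^sup>2 * l" by (simp add: XP algebra_simps)
    ultimately show ?thesis using key unfolding M_def[symmetric] lM_def[symmetric]
      by (simp add: algebra_simps)
  qed
  then show ?thesis by blast
qed

text \<open>This exchanges a pointwise deviation \<open>d\<close> for a variance \<open>v\<close>.
  Bounding the square of \<open>\<bar>\<alpha>\<bar> + \<bar>d\<bar>\<close> by
  \<open>2 * (\<alpha>\<^sup>2 + d\<^sup>2)\<close> costs \<open>ln 2 \<le> 1\<close>, and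
  \<open>d\<^sup>2\<close> exceeds \<open>v * exp t\<close> only in the tail recorded by the
  maximum.\<close>

lemma ln_shift_le:
  fixes \<alpha> c d t v :: real
  assumes "0 < c" "0 < v" "d \<noteq> 0" "0 \<le> t"
  shows "ln (1 + c * exp (- t) / (\<alpha>\<^sup>2 + v))
      \<le> ln (1 + c / (\<bar>\<alpha>\<bar> + \<bar>d\<bar>)\<^sup>2) + 1 + max 0 (ln (d\<^sup>2 / (v * exp t)))"
proof -
  define w where "w = \<alpha>\<^sup>2 + v"
  define N where "N = (\<bar>\<alpha>\<bar> + \<bar>d\<bar>)\<^sup>2"
  define E where "E = exp (max 0 (ln (d\<^sup>2 / (v * exp t))))"
  have w: "0 < w" using assms by (simp add: w_def add_nonneg_pos)
  have N: "0 < N" using assms by (simp add: N_def)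
  have E1: "1 \<le> E" by (simp add: E_def)
  have "d\<^sup>2 / (v * exp t) = exp (ln (d\<^sup>2 / (v * exp t)))" using assms by (subst exp_ln) auto
  also have "\<dots> \<le> E" by (simp add: E_def)
  finally have E2: "d\<^sup>2 * exp (- t) \<le> v * E" using assms by (simp add: exp_minus field_simps)
  have "N \<le> 2 * (\<alpha>\<^sup>2 + d\<^sup>2)"
    using sum_squares_bound[of "\<bar>\<alpha>\<bar>" "\<bar>d\<bar>"] by (simp add: N_def power2_sum)
  then have "N * exp (- t) \<le> 2 * (\<alpha>\<^sup>2 * exp (- t) + d\<^sup>2 * exp (- t))"
    by (metis (no_types, lifting) distrib_right exp_ge_zero mult.assoc mult_right_mono)
  also have "\<dots> \<le> 2 * (\<alpha>\<^sup>2 * E + v * E)"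
    using E1 E2 assms by (intro mult_left_mono add_mono) (auto intro: order_trans[of _ 1])
  finally have "exp (- t) / w \<le> 2 * E / N" using w N by (simp add: field_simps w_def)
  then have "c * (exp (- t) / w) \<le> c * (2 * E / N)" using assms by (intro mult_left_mono) auto
  then have "1 + c * exp (- t) / w \<le> 2 * E * (1 + c / N)" using E1 by (simp add: algebra_simps)
  then have "ln (1 + c * exp (- t) / w) \<le> ln (2 * E * (1 + c / N))"
    using assms w
      by (subst ln_le_cancel_iff) (auto intro!: add_pos_pos mult_pos_pos divide_pos_pos simp: E_def N)
  also have "\<dots> = ln 2 + ln E + ln (1 + c / N)"
  proof -
    have "0 < 1 + c / N" using assms N by (simp add: add_pos_pos)
    then show ?thesis using E1 by (simp add: ln_mult)
  qed
  also have "ln (2::real) \<le> 1" using ln_le_minus_one[of 2] by simp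
  finally show ?thesis by (simp add: E_def w_def N_def)
qed

text \<open>Convexity of \<open>x ln (x / V)\<close>, in the form of Fenchel's inequality at the slope attained
  by \<open>d\<^sup>2\<close>.\<close>

lemma sum_square_ln_le:
  fixes d :: "'k \<Rightarrow> real"
  assumes "finite K" "\<And>k. k \<in> K \<Longrightarrow> 0 < lam k" "(\<Sum>k\<in>K. lam k) \<le> 1" "0 < V"
  shows "(\<Sum>k\<in>K. d k)\<^sup>2 * max 0 (ln ((\<Sum>k\<in>K. d k)\<^sup>2 / V))
    \<le> (\<Sum>k\<in>K. 1 / lam k * ((d k)\<^sup>2 * max 0 (ln ((d k)\<^sup>2 / ((lam k)\<^sup>2 * V)))))"
proof -
  define D where "D = (\<Sum>k\<in>K. d k)\<^sup>2"
  define L where "L = max 0 (ln (D / V))"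
  define X where "X = (\<Sum>k\<in>K. (d k)\<^sup>2 / lam k)"
  have lam: "0 \<le> lam k" "lam k \<noteq> 0" if "k \<in> K" for k using assms(2)[OF that] by auto
  have X0: "0 \<le> X" unfolding X_def by (intro sum_nonneg divide_nonneg_nonneg) (simp_all add: lam)
  \<comment> \<open>Cauchy-Schwarz with the weights \<open>lam\<close>, whose sum is at most
    1.\<close>
  have "D = (\<Sum>k\<in>K. sqrt (lam k) * (d k / sqrt (lam k)))\<^sup>2"
    unfolding D_def using lam by (intro arg_cong[where f="\<lambda>x. x\<^sup>2"] sum.cong) simp_all
  also have "\<dots> \<le> (\<Sum>k\<in>K. (sqrt (lam k))\<^sup>2) * (\<Sum>k\<in>K. (d k / sqrt (lam k))\<^sup>2)"
    by (rule Cauchy_Schwarz_ineq_sum)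
  also have "(\<Sum>k\<in>K. (sqrt (lam k))\<^sup>2) = (\<Sum>k\<in>K. lam k)"
    using lam by (intro sum.cong) simp_all
  also have "(\<Sum>k\<in>K. (d k / sqrt (lam k))\<^sup>2) = X"
    unfolding X_def using lam by (intro sum.cong) (simp_all add: power_divide)
  also have "(\<Sum>k\<in>K. lam k) * X \<le> 1 * X" using assms X0 by (intro mult_right_mono) auto
  finally have DX: "D \<le> X" by simp
  have nonneg: "0 \<le> (\<Sum>k\<in>K. 1 / lam k * ((d k)\<^sup>2 * max 0 (ln ((d k)\<^sup>2 / ((lam k)\<^sup>2 * V)))))"
    using lam by (intro sum_nonneg mult_nonneg_nonneg) simp_all
  have "D * L \<le> (\<Sum>k\<in>K. 1 / lam k * ((d k)\<^sup>2 * max 0 (ln ((d k)\<^sup>2 / ((lam k)\<^sup>2 * V)))))"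
  proof (cases "L = 0")
    case True
    then show ?thesis using nonneg by simp
  next
    case False
    have D: "0 < D"
    proof (rule ccontr)
      assume "\<not> 0 < D"
      then have "D = 0" by (simp add: D_def)
      with False show False by (simp add: L_def)
    qed
    have eL: "V * exp L = D" using False D assms by (auto simp: L_def max_def split: if_splits)
    have "D * L \<le> X * L" using DX by (intro mult_right_mono) (simp_all add: L_def)
    also have "\<dots> = (\<Sum>k\<in>K. lam k * ((d k)\<^sup>2 / (lam k)\<^sup>2 * L))"
      unfolding X_def sum_distrib_right using lam
      by (intro sum.cong) (auto simp: power2_eq_square)
    \<comment> \<open>Fenchel: \<open>x * L \<le> x * ln (x / V) - x + V * exp L\<close> for
      \<open>x = (d k / lam k)\<^sup>2\<close>, where \<open>V * exp L = D\<close>. After summation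
      the surplus is at most \<open>D - X\<close>, which is nonpositive.\<close>
    also have "\<dots>
        \<le> (\<Sum>k\<in>K. lam k * ((d k)\<^sup>2 / (lam k)\<^sup>2 * max 0 (ln ((d k)\<^sup>2 / ((lam k)\<^sup>2 * V))) - (d k)\<^sup>2 / (lam k)\<^sup>2 + D))"
    proof (intro sum_mono mult_left_mono)
      fix k assume k: "k \<in> K"
      define x where "x = (d k)\<^sup>2 / (lam k)\<^sup>2"
      have x0: "0 \<le> x" by (simp add: x_def)
      have xV: "(d k)\<^sup>2 / ((lam k)\<^sup>2 * V) = x / V" by (simp add: x_def)
      have "x * L \<le> x * max 0 (ln (x / V)) - x + D"
      proof (cases "x = 0")
        case False
        then have x: "0 < x" using x0 by simp
        have "L - ln (x / V) = ln (V * exp L / x)"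
          using x assms by (simp add: ln_div ln_mult)
        also have "\<dots> \<le> V * exp L / x - 1" using x assms by (intro ln_le_minus_one) auto
        finally have "x * (L - ln (x / V)) \<le> x * (D / x - 1)"
          using x unfolding eL by (intro mult_left_mono) auto
        then have "x * L \<le> x * ln (x / V) - x + D" using x by (simp add: algebra_simps)
        also have "x * ln (x / V) \<le> x * max 0 (ln (x / V))" using x by (intro mult_left_mono) auto
        finally show ?thesis by simp
      qed (use D in simp)
      then show "(d k)\<^sup>2 / (lam k)\<^sup>2 * L
          \<le> (d k)\<^sup>2 / (lam k)\<^sup>2 * max 0 (ln ((d k)\<^sup>2 / ((lam k)\<^sup>2 * V))) - (d k)\<^sup>2 / (lam k)\<^sup>2 + D"
        unfolding xV x_def[symmetric] .
      show "0 \<le> lam k" using assms(2)[OF k] by simp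
    qed
    also have "\<dots>
        = (\<Sum>k\<in>K. 1 / lam k * ((d k)\<^sup>2 * max 0 (ln ((d k)\<^sup>2 / ((lam k)\<^sup>2 * V)))) - (d k)\<^sup>2 / lam k + lam k * D)"
      using lam by (intro sum.cong refl) (auto simp: power2_eq_square algebra_simps)
    also have "\<dots>
        = (\<Sum>k\<in>K. 1 / lam k * ((d k)\<^sup>2 * max 0 (ln ((d k)\<^sup>2 / ((lam k)\<^sup>2 * V))))) - X + (\<Sum>k\<in>K. lam k) * D"
      by (simp add: sum.distrib sum_subtractf X_def sum_distrib_right)
    also have "(\<Sum>k\<in>K. lam k) * D \<le> 1 * D" using assms D by (intro mult_right_mono) auto
    finally show ?thesis using DX by simp
  qed
  then show ?thesis by (simp add: D_def L_def)
qed

text \<open>The logarithm is split at a threshold \<open>m\<close> and the excess is bounded by its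
  exponential, which charges large values to \<open>x\<^sup>2\<close>. When \<open>x\<close> is the
  square of a Walsh sum, this is the fourth power that Bonami's inequality controls.\<close>

lemma mult_max_ln_le:
  fixes x v t m :: real
  assumes "0 \<le> x" "0 < v"
  shows "x * max 0 (ln (x / (v * exp t))) \<le> x * max 0 (m - t) + x\<^sup>2 * exp (- m) / v"
proof (cases "x = 0")
  case False
  then have x: "0 < x" using assms by simp
  have "ln (x / (v * exp t)) = (m - t) + (ln (x / v) - m)"
    using x assms by (simp add: ln_div ln_mult)
  also have "\<dots> \<le> max 0 (m - t) + exp (ln (x / v) - m)"
    using exp_ge_add_one_self[of "ln (x / v) - m"] by (intro add_mono) linarith+
  also have "exp (ln (x / v) - m) = x / v * exp (- m)"
    using x assms by (simp add: exp_diff exp_minus field_simps)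
  finally have "max 0 (ln (x / (v * exp t))) \<le> max 0 (m - t) + x / v * exp (- m)"
    using x assms by simp
  then have "x * max 0 (ln (x / (v * exp t))) \<le> x * (max 0 (m - t) + x / v * exp (- m))"
    using x by (intro mult_left_mono) auto
  then show ?thesis by (simp add: algebra_simps power2_eq_square)
qed simp

text \<open>This is \<open>y \<le> exp y\<close> at \<open>y = k / 10 - u\<close>. The base 9/8 is
  chosen so that its product with the growth rate 4/3 of the level weights is 3/2.\<close>

lemma max_le_exp:
  fixes k u :: nat
  shows "max 0 (4 * real k - 40 * real u) \<le> 40 * ((9 / 8) ^ k * (1 / 2) ^ u)"
proof -
  have "max 0 (4 * real k - 40 * real u) \<le> 40 * exp (real k / 10 - real u)"
  proof -
    have "4 * real k - 40 * real u \<le> 40 * exp (real k / 10 - real u)"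
      using exp_ge_add_one_self[of "real k / 10 - real u"] by (simp add: field_simps)
    then show ?thesis by simp
  qed
  also have "exp (real k / 10 - real u) = exp (1 / 10) ^ k * exp (- 1) ^ u"
  proof -
    have "real k / 10 - real u = real k * (1 / 10) + real u * (- 1)" by simp
    then show ?thesis by (simp only: exp_add exp_of_nat_mult)
  qed
  also have "\<dots> \<le> (9 / 8) ^ k * (1 / 2) ^ u"
  proof (intro mult_mono power_mono)
    have "9 / 10 \<le> exp (- 1 / 10 :: real)" using exp_ge_add_one_self[of "- 1 / 10 :: real"] by simp
    then show "exp (1 / 10 :: real) \<le> 9 / 8" by (simp add: exp_minus field_simps)
    have "2 \<le> exp (1 :: real)" using exp_ge_add_one_self[of "1 :: real"] by simp
    then show "exp (- 1 :: real) \<le> 1 / 2" by (simp add: exp_minus field_simps)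
  qed auto
  finally show ?thesis by simp
qed

lemma exp_4_ge: "25 \<le> exp (4 :: real)"
proof -
  have "(3 / 2) ^ 8 \<le> exp (1 / 2 :: real) ^ 8"
    using exp_ge_add_one_self[of "1 / 2 :: real"] by (intro power_mono) auto
  also have "\<dots> = exp (4 :: real)" using exp_of_nat_mult[of 8 "1 / 2 :: real"] by simp
  finally show ?thesis by (simp add: eval_nat_numeral)
qed

lemma sum_geometric_le_1: "(\<Sum>k\<in>{1..n}. 1 / 3 * (3 / 4) ^ k) \<le> (1 :: real)"
proof -
  have "(\<Sum>k\<in>{1..n}. 1 / 3 * (3 / 4) ^ k) = 1 - (3 / 4 :: real) ^ n"
    by (induction n) (auto simp: algebra_simps)
  then show ?thesis by simp
qed

section \<open>Decomposition by degree and the lower bound for averages of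
  \<open>psi\<close>\<close>

lemma walsh_sum_levels:
  assumes "finite J"
  shows "walsh_sum J b Y
      = b {} + (\<Sum>k\<in>{1..card J}. walsh_sum J (\<lambda>V. if card V = k then b V else 0) Y)"
proof -
  have "(\<Sum>k\<in>{1..card J}. walsh_sum J (\<lambda>V. if card V = k then b V else 0) Y)
      = (\<Sum>V\<in>Pow J. \<Sum>k\<in>{1..card J}. if card V = k then b V * walsh V Y else 0)"
    unfolding walsh_sum_def by (subst sum.swap) (intro sum.cong refl, simp)
  also have "\<dots> = (\<Sum>V\<in>Pow J. if V = {} then 0 else b V * walsh V Y)"
  proof (intro sum.cong refl)
    fix V assume "V \<in> Pow J"
    then have "card V \<le> card J" "finite V" using assms by (auto intro: card_mono finite_subset)
    then show "(\<Sum>k\<in>{1..card J}. if card V = k then b V * walsh V Y else 0)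
        = (if V = {} then 0 else b V * walsh V Y)"
      by (auto simp: Suc_le_eq card_gt_0_iff)
  qed
  also have "\<dots> = (\<Sum>V\<in>Pow J - {{}}. b V * walsh V Y)"
    using assms by (intro sum.mono_neutral_cong_right) auto
  finally show ?thesis
    unfolding walsh_sum_def using assms by (subst sum.remove[where x = "{}"]) auto
qed

lemma sum_levels:
  fixes \<phi> :: "nat \<Rightarrow> real"
  assumes "finite J"
  shows "(\<Sum>k\<in>{1..card J}. \<phi> k * (\<Sum>V\<in>Pow J. (if card V = k then b V else 0)\<^sup>2))
      = (\<Sum>V\<in>Pow J - {{}}. (b V)\<^sup>2 * \<phi> (card V))"
proof -
  have "(\<Sum>k\<in>{1..card J}. \<phi> k * (\<Sum>V\<in>Pow J. (if card V = k then b V else 0)\<^sup>2))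
     = (\<Sum>V\<in>Pow J. \<Sum>k\<in>{1..card J}. if card V = k then (b V)\<^sup>2 * \<phi> k else 0)"
    unfolding sum_distrib_left by (subst sum.swap) (intro sum.cong refl, simp)
  also have "\<dots> = (\<Sum>V\<in>Pow J. if V = {} then 0 else (b V)\<^sup>2 * \<phi> (card V))"
  proof (intro sum.cong refl)
    fix V assume "V \<in> Pow J"
    then have "card V \<le> card J" "finite V" using assms by (auto intro: card_mono finite_subset)
    then show "(\<Sum>k\<in>{1..card J}. if card V = k then (b V)\<^sup>2 * \<phi> k else 0)
        = (if V = {} then 0 else (b V)\<^sup>2 * \<phi> (card V))"
      by (auto simp: Suc_le_eq card_gt_0_iff)
  qed
  also have "\<dots> = (\<Sum>V\<in>Pow J - {{}}. (b V)\<^sup>2 * \<phi> (card V))"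
    using assms by (intro sum.mono_neutral_cong_right) auto
  finally show ?thesis .
qed

text \<open>A reverse Jensen inequality with controlled loss. The Walsh sum is \<open>b {}\<close>
  plus a deviation; in the averaged tangent bound the linear term vanishes and the quadratic one
  gives \<open>v\<close>. Replacing the deviation inside the logarithm by the mean square
  \<open>w\<close> leaves tails, which are estimated degree by degree. The discount
  \<open>exp (- (40 * real u))\<close> keeps the tails small unless \<open>card V\<close> is large
  compared with \<open>u\<close>.\<close>

lemma avg_psi_walsh_sum_ge:
  fixes b :: "'a set \<Rightarrow> real" and u :: nat
  assumes J: "finite J" and c: "0 < c"
  defines "v \<equiv> (\<Sum>V\<in>Pow J - {{}}. (b V)\<^sup>2)" and "w \<equiv> (\<Sum>V\<in>Pow J. (b V)\<^sup>2)"
  shows "psi c ((b {})\<^sup>2) + v * ln (1 + c * exp (- (40 * real u)) / w)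
      - (\<Sum>V\<in>Pow J - {{}}. (b V)\<^sup>2 * (40 + 120 * ((3 / 2) ^ card V * (1 / 2) ^ u)))
    \<le> avg (Pow J) (\<lambda>Y. psi c ((walsh_sum J b Y)\<^sup>2))"
proof (cases "v = 0")
  case True
  then have b0: "b V = 0" if "V \<in> Pow J - {{}}" for V
    using that J by (simp add: v_def sum_nonneg_eq_0_iff)
  have "walsh_sum J b Y = b {}" for Y
    unfolding walsh_sum_def using J b0 by (subst sum.remove[where x = "{}"]) auto
  then show ?thesis using J True b0 by (simp add: v_def)
next
  case False
  then have v: "0 < v" by (simp add: v_def order_less_le sum_nonneg)
  define \<alpha> where "\<alpha> = b {}"
  define t where "t = 40 * real u"
  define K where "K = {1..card J}"
  define bk where "bk = (\<lambda>k V. if card V = k then b V else 0)"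
  define dk where "dk = (\<lambda>k. walsh_sum J (bk k))"
  define d where "d = (\<lambda>Y. \<Sum>k\<in>K. dk k Y)"
  define vk where "vk = (\<lambda>k. \<Sum>V\<in>Pow J. (bk k V)\<^sup>2)"
  \<comment> \<open>Summable weights for combining the degrees, with \<open>1 / lam k\<close>
    growing only like \<open>(4 / 3) ^ k\<close>.\<close>
  define lam :: "nat \<Rightarrow> real" where "lam = (\<lambda>k. 1 / 3 * (3 / 4) ^ k)"
  have w: "w = \<alpha>\<^sup>2 + v"
    unfolding w_def v_def \<alpha>_def using J by (subst sum.remove[where x = "{}"]) auto
  have g: "walsh_sum J b Y = \<alpha> + d Y" for Y
    unfolding \<alpha>_def d_def K_def dk_def bk_def by (rule walsh_sum_levels[OF J])
  have avg_d: "avg (Pow J) d = 0"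
  proof -
    have "avg (Pow J) (\<lambda>Y. \<alpha> + d Y) = b {}" unfolding g[symmetric] using avg_walsh_sum[OF J, of b] .
    then show ?thesis using J by (simp add: avg_add \<alpha>_def)
  qed
  have avg_d2: "avg (Pow J) (\<lambda>Y. (d Y)\<^sup>2) = v"
  proof -
    have "avg (Pow J) (\<lambda>Y. (\<alpha> + d Y)\<^sup>2) = \<alpha>\<^sup>2 + v" using parseval[OF J, of b] w
      by (simp add: g w_def)
    moreover have "(\<alpha> + d Y)\<^sup>2 = \<alpha>\<^sup>2 + 2 * \<alpha> * d Y + (d Y)\<^sup>2" for Y
      by (simp add: power2_sum algebra_simps)
    ultimately show ?thesis using J avg_d by (simp add: avg_add avg_mult_left)
  qed
  obtain s where s: "\<And>d. psi c (\<alpha>\<^sup>2) + s * d + d\<^sup>2 * ln (1 + c / (\<bar>\<alpha>\<bar> + \<bar>d\<bar>)\<^sup>2) - 12 * d\<^sup>2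
      \<le> psi c ((\<alpha> + d)\<^sup>2)"
    using psi_square_tangent[OF c] by blast
  define l where "l = ln (1 + c * exp (- t) / w)"
  define tail where "tail = (\<lambda>Y. (d Y)\<^sup>2 * max 0 (ln ((d Y)\<^sup>2 / (v * exp t))))"
  \<comment> \<open>The 13 is 12 from the tangent bound plus 1 from
    \<open>ln_shift_le\<close>.\<close>
  have pointwise: "psi c (\<alpha>\<^sup>2) + s * d Y + (l - 13) * (d Y)\<^sup>2 - tail Y
      \<le> psi c ((walsh_sum J b Y)\<^sup>2)" for Y
  proof (cases "d Y = 0")
    case True
    then show ?thesis by (simp add: g tail_def)
  next
    case False
    have "l \<le> ln (1 + c / (\<bar>\<alpha>\<bar> + \<bar>d Y\<bar>)\<^sup>2) + 1 + max 0 (ln ((d Y)\<^sup>2 / (v * exp t)))"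
      unfolding l_def w using c v False by (intro ln_shift_le) (auto simp: t_def)
    then have "(d Y)\<^sup>2 * l
        \<le> (d Y)\<^sup>2 * (ln (1 + c / (\<bar>\<alpha>\<bar> + \<bar>d Y\<bar>)\<^sup>2) + 1 + max 0 (ln ((d Y)\<^sup>2 / (v * exp t))))"
      by (intro mult_left_mono) auto
    then have "(d Y)\<^sup>2 * l \<le> (d Y)\<^sup>2 * ln (1 + c / (\<bar>\<alpha>\<bar> + \<bar>d Y\<bar>)\<^sup>2) + (d Y)\<^sup>2 + tail Y"
      by (simp add: tail_def distrib_left)
    moreover have "(l - 13) * (d Y)\<^sup>2 = (d Y)\<^sup>2 * l - 13 * (d Y)\<^sup>2" by (simp add: algebra_simps)
    ultimately show ?thesis using s[of "d Y"] unfolding g by linarith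
  qed
  have "psi c (\<alpha>\<^sup>2) + (l - 13) * v - avg (Pow J) tail
      = avg (Pow J) (\<lambda>Y. psi c (\<alpha>\<^sup>2) + s * d Y + (l - 13) * (d Y)\<^sup>2 - tail Y)"
    using J by (simp add: avg_add avg_diff avg_mult_left avg_d avg_d2)
  also have "\<dots> \<le> avg (Pow J) (\<lambda>Y. psi c ((walsh_sum J b Y)\<^sup>2))"
    using pointwise by (intro avg_mono)
  finally have main: "psi c (\<alpha>\<^sup>2) + (l - 13) * v - avg (Pow J) tail
      \<le> avg (Pow J) (\<lambda>Y. psi c ((walsh_sum J b Y)\<^sup>2))" .

  have lam: "0 < lam k" for k by (simp add: lam_def)
  have vk0: "0 \<le> vk k" for k by (simp add: vk_def sum_nonneg)
  have vkv: "vk k \<le> v" if "k \<in> K" for k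
  proof -
    have "vk k \<le> (\<Sum>k\<in>K. 1 * vk k)" using that vk0 by (simp add: member_le_sum K_def)
    also have "\<dots> = v" unfolding K_def vk_def bk_def v_def by (subst sum_levels[OF J]) simp
    finally show ?thesis .
  qed
  have level: "avg (Pow J) (\<lambda>Y. 1 / lam k
      * ((dk k Y)\<^sup>2 * max 0 (ln ((dk k Y)\<^sup>2 / ((lam k)\<^sup>2 * (v * exp t))))))
      \<le> (27 + 120 * ((3 / 2) ^ k * (1 / 2) ^ u)) * vk k" if k: "k \<in> K" for k
  proof -
    \<comment> \<open>At this threshold \<open>exp (- m)\<close> beats the factor
      \<open>9 ^ k\<close> from Bonami together with \<open>(4 / 3) ^ (3 * k)\<close> from the
      weights, because \<open>9 * (4 / 3) ^ 3 < 25 \<le> exp 4\<close>.\<close>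
    define m where "m = 4 * real k"
    have p4: "((dk k Y)\<^sup>2)\<^sup>2 = dk k Y ^ 4" for Y by (simp add: power2_eq_square power4_eq_xxxx)
    have "avg (Pow J) (\<lambda>Y. (dk k Y)\<^sup>2 * max 0 (ln ((dk k Y)\<^sup>2 / ((lam k)\<^sup>2 * (v * exp t)))))
      \<le> avg (Pow J) (\<lambda>Y. max 0 (m - t) * (dk k Y)\<^sup>2 + exp (- m) / ((lam k)\<^sup>2 * v) * dk k Y ^ 4)"
    proof (intro avg_mono)
      fix Y
      have "(dk k Y)\<^sup>2 * max 0 (ln ((dk k Y)\<^sup>2 / ((lam k)\<^sup>2 * v * exp t)))
          \<le> (dk k Y)\<^sup>2 * max 0 (m - t) + ((dk k Y)\<^sup>2)\<^sup>2 * exp (- m) / ((lam k)\<^sup>2 * v)"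
        using lam[of k] v by (intro mult_max_ln_le) auto
      then show "(dk k Y)\<^sup>2 * max 0 (ln ((dk k Y)\<^sup>2 / ((lam k)\<^sup>2 * (v * exp t))))
          \<le> max 0 (m - t) * (dk k Y)\<^sup>2 + exp (- m) / ((lam k)\<^sup>2 * v) * dk k Y ^ 4"
        unfolding p4 by (simp add: mult_ac)
    qed
    also have "\<dots>
        = max 0 (m - t) * vk k + exp (- m) / ((lam k)\<^sup>2 * v) * avg (Pow J) (\<lambda>Y. dk k Y ^ 4)"
      using parseval[OF J, of "bk k"] by (simp only: avg_add avg_mult_left dk_def vk_def)
    also have "\<dots> \<le> max 0 (m - t) * vk k + exp (- m) / ((lam k)\<^sup>2 * v) * (9 ^ k * (v * vk k))"
    proof -
      have "avg (Pow J) (\<lambda>Y. dk k Y ^ 4) \<le> 9 ^ k * (vk k)\<^sup>2"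
        unfolding dk_def vk_def by (rule bonami_level[OF J]) (simp add: bk_def)
      \<comment> \<open>One factor \<open>vk k\<close> is raised to the whole variance
        \<open>v\<close>, to cancel the \<open>v\<close> in the denominator.\<close>
      also have "\<dots> \<le> 9 ^ k * (v * vk k)"
        using vk0[of k] vkv[OF k] by (simp add: power2_eq_square mult_right_mono)
      finally show ?thesis using v by (intro add_left_mono mult_left_mono) auto
    qed
    also have "\<dots> = (max 0 (m - t) + exp (- m) * 9 ^ k / (lam k)\<^sup>2) * vk k"
      using v by (simp add: algebra_simps)
    finally have "1 / lam k
        * avg (Pow J) (\<lambda>Y. (dk k Y)\<^sup>2 * max 0 (ln ((dk k Y)\<^sup>2 / ((lam k)\<^sup>2 * (v * exp t)))))
      \<le> 1 / lam k * ((max 0 (m - t) + exp (- m) * 9 ^ k / (lam k)\<^sup>2) * vk k)"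
      using lam[of k] by (intro mult_left_mono) auto
    also have "\<dots> = (1 / lam k * max 0 (m - t) + exp (- m) * 9 ^ k * (1 / lam k) ^ 3) * vk k"
      by (simp add: algebra_simps power2_eq_square power3_eq_cube)
    also have "\<dots> \<le> (27 + 120 * ((3 / 2) ^ k * (1 / 2) ^ u)) * vk k"
    proof (rule mult_right_mono)
      have il: "1 / lam k = 3 * (4 / 3) ^ k" by (simp add: lam_def power_divide)
      have "1 / lam k * max 0 (m - t) \<le> 3 * (4 / 3) ^ k * (40 * ((9 / 8) ^ k * (1 / 2) ^ u))"
        unfolding il m_def t_def by (intro mult_left_mono max_le_exp) auto
      also have "\<dots> = 120 * (((4 / 3) * (9 / 8)) ^ k * (1 / 2) ^ u)"
        by (simp only: power_mult_distrib)
      finally have 1: "1 / lam k * max 0 (m - t) \<le> 120 * ((3 / 2) ^ k * (1 / 2) ^ u)" by simp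
      have "- m = real k * (- 4)" by (simp add: m_def)
      then have "exp (- m) = exp (- 4) ^ k" by (simp only: exp_of_nat_mult)
      moreover have "(3 * (4 / 3 :: real) ^ k) ^ 3 = 27 * ((4 / 3) ^ 3) ^ k"
        by (simp add: power_mult_distrib power_commutes flip: power_mult)
      ultimately have "exp (- m) * 9 ^ k * (1 / lam k) ^ 3 = 27 * (exp (- 4) * 9 * (4 / 3) ^ 3) ^ k"
        unfolding il by (simp only: power_mult_distrib mult_ac)
      also have "\<dots> \<le> 27 * 1"
      proof (intro mult_left_mono power_le_one)
        show "exp (- 4) * 9 * (4 / 3) ^ 3 \<le> (1 :: real)"
          using exp_4_ge by (simp add: exp_minus field_simps power3_eq_cube)
      qed auto
      finally show "1 / lam k * max 0 (m - t) + exp (- m) * 9 ^ k * (1 / lam k) ^ 3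
          \<le> 27 + 120 * ((3 / 2) ^ k * (1 / 2) ^ u)"
        using 1 by simp
    qed (rule vk0)
    finally show ?thesis by (simp only: avg_mult_left)
  qed
  have "avg (Pow J) tail
      \<le> avg (Pow J) (\<lambda>Y. \<Sum>k\<in>K. 1 / lam k * ((dk k Y)\<^sup>2 * max 0 (ln ((dk k Y)\<^sup>2 / ((lam k)\<^sup>2 * (v * exp t))))))"
    unfolding tail_def d_def using lam v sum_geometric_le_1[of "card J"]
    by (intro avg_mono sum_square_ln_le) (auto simp: K_def lam_def)
  also have "\<dots>
      = (\<Sum>k\<in>K. avg (Pow J) (\<lambda>Y. 1 / lam k * ((dk k Y)\<^sup>2 * max 0 (ln ((dk k Y)\<^sup>2 / ((lam k)\<^sup>2 * (v * exp t)))))))"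
    by (rule avg_sum)
  also have "\<dots> \<le> (\<Sum>k\<in>K. (27 + 120 * ((3 / 2) ^ k * (1 / 2) ^ u)) * vk k)"
    using level by (intro sum_mono)
  also have "\<dots> = (\<Sum>V\<in>Pow J - {{}}. (b V)\<^sup>2 * (27 + 120 * ((3 / 2) ^ card V * (1 / 2) ^ u)))"
    unfolding K_def vk_def bk_def by (rule sum_levels[OF J])
  \<comment> \<open>Here \<open>40 = 27 + 13\<close>: the tail constant plus the pointwise
    loss.\<close>
  finally have "avg (Pow J) tail + 13 * v
      \<le> (\<Sum>V\<in>Pow J - {{}}. (b V)\<^sup>2 * (40 + 120 * ((3 / 2) ^ card V * (1 / 2) ^ u)))"
    by (simp add: v_def distrib_left sum.distrib sum_distrib_right[symmetric])
  with main show ?thesis by (simp add: \<alpha>_def l_def t_def algebra_simps)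
qed

section \<open>Splitting the coordinate set\<close>

lemma avg_avg_square_diff:
  assumes "finite A" "A \<noteq> {}"
  shows "avg A (\<lambda>x. avg A (\<lambda>y. (g x - g y)\<^sup>2)) = 2 * (avg A (\<lambda>x. (g x)\<^sup>2) - (avg A g)\<^sup>2)"
proof -
  have "(g x - g y)\<^sup>2 = (g x)\<^sup>2 + (g y)\<^sup>2 - 2 * g x * g y" for x y
    by (simp add: power2_diff)
  then show ?thesis
    using assms
    by (simp add: avg_add avg_diff avg_mult_left avg_mult_right power2_eq_square)
qed

text \<open>If a two-valued function varies along some row and along some column, then one of three
  rectangles spanned by these points has a non-vanishing mixed difference.\<close>

lemma variance_product_le_mixed_variance:
  fixes F :: "'a \<Rightarrow> 'b \<Rightarrow> real"
  assumes A: "finite A" "A \<noteq> {}" and B: "finite B" "B \<noteq> {}"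
    and F: "\<And>x y. x \<in> A \<Longrightarrow> y \<in> B \<Longrightarrow> F x y \<in> {0, 1}"
  defines "S \<equiv> avg A (\<lambda>x. avg B (\<lambda>y. (F x y)\<^sup>2))"
    and "S1 \<equiv> avg B (\<lambda>y. (avg A (\<lambda>x. F x y))\<^sup>2)"
    and "S2 \<equiv> avg A (\<lambda>x. (avg B (\<lambda>y. F x y))\<^sup>2)"
    and "S0 \<equiv> (avg A (\<lambda>x. avg B (\<lambda>y. F x y)))\<^sup>2"
  shows "(S - S1) * (S - S2) \<le> 3 * (S - S1 - S2 + S0)"
proof -
  define sq where "sq = (\<lambda>x x' y y'. ((F x y - F x' y) - (F x y' - F x' y'))\<^sup>2)"
  define K where "K = avg A (\<lambda>x. avg A (\<lambda>x'. avg B (\<lambda>y. avg B (\<lambda>y'. sq x x' y y'))))"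
  \<comment> \<open>\<open>S - S1\<close> is the mean variance in the first argument,
    \<open>S - S2\<close> the one in the second.\<close>
  have rows: "avg A (\<lambda>x. avg A (\<lambda>x'. avg B (\<lambda>y. (F x y - F x' y)\<^sup>2))) = 2 * (S - S1)"
  proof -
    have "avg A (\<lambda>x. avg A (\<lambda>x'. avg B (\<lambda>y. (F x y - F x' y)\<^sup>2)))
        = avg B (\<lambda>y. avg A (\<lambda>x. avg A (\<lambda>x'. (F x y - F x' y)\<^sup>2)))"
      by (simp only: avg_swap[of A B])
    also have "\<dots> = 2 * (avg B (\<lambda>y. avg A (\<lambda>x. (F x y)\<^sup>2)) - S1)"
      using A by (simp add: avg_avg_square_diff avg_mult_left avg_diff S1_def)
    also have "avg B (\<lambda>y. avg A (\<lambda>x. (F x y)\<^sup>2)) = S" unfolding S_def by (rule avg_swap)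
    finally show ?thesis .
  qed
  have cols: "avg A (\<lambda>x. avg B (\<lambda>y. avg B (\<lambda>y'. (F x y - F x y')\<^sup>2))) = 2 * (S - S2)"
    using B by (simp add: avg_avg_square_diff avg_mult_left avg_diff S_def S2_def)
  \<comment> \<open>The variance identity is used once in each argument to evaluate the mean square
    of the mixed difference.\<close>
  have "K = avg A (\<lambda>x. avg A (\<lambda>x'. 2
      * (avg B (\<lambda>y. (F x y - F x' y)\<^sup>2) - (avg B (\<lambda>y. F x y - F x' y))\<^sup>2)))"
    unfolding K_def sq_def using B by (intro avg_cong avg_avg_square_diff)
  also have "\<dots> = 2 * (2 * (S - S1) - 2 * (S2 - S0))"
    using A
      by (simp add: avg_mult_left avg_diff avg_avg_square_diff S2_def S0_def rows[unfolded avg_diff])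
  finally have K: "K = 4 * (S - S1 - S2 + S0)" by simp
  have ptw: "(F x y - F x' y)\<^sup>2 * (F u w - F u w')\<^sup>2 \<le> sq x x' y w + sq x u w w' + sq x x' w w'"
    if "x \<in> A" "x' \<in> A" "u \<in> A" "y \<in> B" "w \<in> B" "w' \<in> B" for x x' u y w w'
  proof -
    have *: "F x y = 0 \<or> F x y = 1" "F x' y = 0 \<or> F x' y = 1" "F x w = 0 \<or> F x w = 1"
        "F x' w = 0 \<or> F x' w = 1"
      "F x w' = 0 \<or> F x w' = 1" "F x' w' = 0 \<or> F x' w' = 1" "F u w = 0 \<or> F u w = 1"
          "F u w' = 0 \<or> F u w' = 1"
      using F that by blast+
    consider "F x y = F x' y" | "F u w = F u w'" | "F x y \<noteq> F x' y" "F u w \<noteq> F u w'" by blast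
    then show ?thesis
    proof cases
      case 3
      have "(F x y - F x' y)\<^sup>2 = 1" using 3(1) *(1,2) by auto
      moreover have "(F u w - F u w')\<^sup>2 = 1" using 3(2) *(7,8) by auto
      ultimately have one: "(F x y - F x' y)\<^sup>2 = 1" "(F u w - F u w')\<^sup>2 = 1" .
      \<comment> \<open>The three rectangles share the corner \<open>(x, w)\<close>. If
        \<open>F\<close> is constant along an edge at that corner, the rectangle joining this edge
        to the given varying pair has mixed difference of modulus 1. Otherwise both neighbours carry
        the other value, and the rectangle on \<open>x, x'\<close> and \<open>w, w'\<close> works
        whatever its fourth corner is.\<close>
      consider "F x w = F x' w" | "F x w = F x w'" | "F x w \<noteq> F x' w" "F x w \<noteq> F x w'" by blast
      then show ?thesis
      proof cases
        case 1
        then have "sq x x' y w = 1" by (simp add: sq_def one)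
        then show ?thesis using one by (simp add: sq_def)
      next
        case 2
        then have "sq x u w w' = 1" using one by (simp add: sq_def power2_commute)
        then show ?thesis using one by (simp add: sq_def)
      next
        case 3
        then have "1 \<le> sq x x' w w'" using *(3-6) by (auto simp: sq_def)
        moreover have "0 \<le> sq x x' y w" "0 \<le> sq x u w w'" by (simp_all add: sq_def)
        ultimately show ?thesis using one by simp
      qed
    qed (simp_all add: sq_def)
  qed
  \<comment> \<open>The two factors involve separate variables, so the sixfold average factors; each
    of the three rectangles averages to \<open>K\<close>.\<close>
  have "(2 * (S - S1)) * (2 * (S - S2))
      = avg A (\<lambda>x. avg A (\<lambda>x'. avg A (\<lambda>u. avg B (\<lambda>y. avg B (\<lambda>w. avg B (\<lambda>w'. (F x y - F x' y)\<^sup>2 * (F u w - F u w')\<^sup>2))))))"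
    by (simp only: avg_mult_left avg_mult_right rows cols)
  also have "\<dots>
      \<le> avg A (\<lambda>x. avg A (\<lambda>x'. avg A (\<lambda>u. avg B (\<lambda>y. avg B (\<lambda>w. avg B (\<lambda>w'. sq x x' y w + sq x u w w' + sq x x' w w'))))))"
    using ptw by (intro avg_mono)
  also have "\<dots> = K + K + K"
    using A B by (simp add: avg_add avg_mult_left K_def)
  finally have "(2 * (S - S1)) * (2 * (S - S2)) \<le> 3 * K" by simp
  moreover have "(2 * (S - S1)) * (2 * (S - S2)) = 4 * ((S - S1) * (S - S2))" by algebra
  ultimately show ?thesis using K by linarith
qed

text \<open>By Parseval the two directional variances are the weights of the sets meeting
  \<open>J1\<close> and of those meeting \<open>J2\<close>, and the mixed variance is the weight of
  the sets meeting both.\<close>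

lemma coeff_product_le_mixed:
  fixes a :: "'a set \<Rightarrow> real"
  assumes J: "finite J1" "finite J2" "J1 \<inter> J2 = {}"
    and F: "\<And>Y. Y \<subseteq> J1 \<union> J2 \<Longrightarrow> walsh_sum (J1 \<union> J2) a Y \<in> {0, 1}"
  shows "(\<Sum>U\<in>Pow J1 - {{}}. \<Sum>V\<in>Pow J2. (a (U \<union> V))\<^sup>2) * (\<Sum>V\<in>Pow J2 - {{}}. \<Sum>U\<in>Pow J1. (a (U \<union> V))\<^sup>2)
    \<le> 3 * (\<Sum>U\<in>Pow J1 - {{}}. \<Sum>V\<in>Pow J2 - {{}}. (a (U \<union> V))\<^sup>2)"
proof -
  define p where "p = (\<lambda>U V. (a (U \<union> V))\<^sup>2)"
  define F where "F = (\<lambda>Y Z. walsh_sum (J1 \<union> J2) a (Y \<union> Z))"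
  have F01: "F Y Z \<in> {0, 1}" if "Y \<in> Pow J1" "Z \<in> Pow J2" for Y Z
  proof -
    have "Y \<union> Z \<subseteq> J1 \<union> J2" using that by auto
    then show ?thesis unfolding F_def by (rule assms(4))
  qed
  have F1: "F Y Z = walsh_sum J1 (\<lambda>U. walsh_sum J2 (\<lambda>V. a (U \<union> V)) Z) Y" if "Y \<in> Pow J1"
      "Z \<in> Pow J2" for Y Z
    unfolding F_def using J that by (intro walsh_sum_Un) auto
  have F2: "F Y Z = walsh_sum J2 (\<lambda>V. walsh_sum J1 (\<lambda>U. a (U \<union> V)) Y) Z" if "Y \<in> Pow J1"
      "Z \<in> Pow J2" for Y Z
    unfolding F_def using J that walsh_sum_Un[of J2 J1 Z Y a] by (simp add: Un_commute Int_commute)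
  define T where "T = (\<Sum>U\<in>Pow J1. \<Sum>V\<in>Pow J2. p U V)"
  have T': "T = (\<Sum>V\<in>Pow J2. \<Sum>U\<in>Pow J1. p U V)" unfolding T_def by (rule sum.swap)
  have S: "avg (Pow J1) (\<lambda>Y. avg (Pow J2) (\<lambda>Z. (F Y Z)\<^sup>2)) = T"
  proof -
    have "avg (Pow J1) (\<lambda>Y. avg (Pow J2) (\<lambda>Z. (F Y Z)\<^sup>2))
        = avg (Pow J1) (\<lambda>Y. \<Sum>V\<in>Pow J2. (walsh_sum J1 (\<lambda>U. a (U \<union> V)) Y)\<^sup>2)"
      using J by (intro avg_cong) (simp add: F2 parseval cong: avg_cong_simp)
    then show ?thesis using J by (simp add: avg_sum parseval T' p_def)
  qed
  have S1: "avg (Pow J2) (\<lambda>Z. (avg (Pow J1) (\<lambda>Y. F Y Z))\<^sup>2) = (\<Sum>V\<in>Pow J2. p {} V)"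
  proof -
    have "avg (Pow J2) (\<lambda>Z. (avg (Pow J1) (\<lambda>Y. F Y Z))\<^sup>2) = avg (Pow J2) (\<lambda>Z. (walsh_sum J2 a Z)\<^sup>2)"
      using J by (intro avg_cong) (simp add: F1 avg_walsh_sum cong: avg_cong_simp)
    then show ?thesis using J by (simp add: parseval p_def)
  qed
  have S2: "avg (Pow J1) (\<lambda>Y. (avg (Pow J2) (\<lambda>Z. F Y Z))\<^sup>2) = (\<Sum>U\<in>Pow J1. p U {})"
  proof -
    have "avg (Pow J1) (\<lambda>Y. (avg (Pow J2) (\<lambda>Z. F Y Z))\<^sup>2) = avg (Pow J1) (\<lambda>Z. (walsh_sum J1 a Z)\<^sup>2)"
      using J by (intro avg_cong) (simp add: F2 avg_walsh_sum cong: avg_cong_simp)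
    then show ?thesis using J by (simp add: parseval p_def)
  qed
  have S0: "(avg (Pow J1) (\<lambda>Y. avg (Pow J2) (\<lambda>Z. F Y Z)))\<^sup>2 = p {} {}"
  proof -
    have "avg (Pow J1) (\<lambda>Y. avg (Pow J2) (\<lambda>Z. F Y Z)) = avg (Pow J1) (walsh_sum J1 a)"
      using J by (intro avg_cong) (simp add: F2 avg_walsh_sum cong: avg_cong_simp)
    then show ?thesis using J by (simp add: avg_walsh_sum p_def)
  qed
  have main: "(T - (\<Sum>V\<in>Pow J2. p {} V)) * (T - (\<Sum>U\<in>Pow J1. p U {}))
      \<le> 3 * (T - (\<Sum>V\<in>Pow J2. p {} V) - (\<Sum>U\<in>Pow J1. p U {}) + p {} {})"
    unfolding S[symmetric] S1[symmetric] S2[symmetric] S0[symmetric]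
    by (intro variance_product_le_mixed_variance) (use J F01 in auto)
  have rm: "(\<Sum>U\<in>Pow J. g U)
      = g {} + (\<Sum>U\<in>Pow J - {{}}. g U)" if "finite J" for g :: "'a set \<Rightarrow> real" and J
    using that by (subst sum.remove[where x = "{}"]) auto
  have m1: "T - (\<Sum>V\<in>Pow J2. p {} V) = (\<Sum>U\<in>Pow J1 - {{}}. \<Sum>V\<in>Pow J2. p U V)"
    unfolding T_def using J rm[of J1 "\<lambda>U. \<Sum>V\<in>Pow J2. p U V"] by simp
  have m2: "T - (\<Sum>U\<in>Pow J1. p U {}) = (\<Sum>V\<in>Pow J2 - {{}}. \<Sum>U\<in>Pow J1. p U V)"
    unfolding T' using J rm[of J2 "\<lambda>V. \<Sum>U\<in>Pow J1. p U V"] by simp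
  have m3: "(\<Sum>U\<in>Pow J1 - {{}}. \<Sum>V\<in>Pow J2. p U V) - (\<Sum>U\<in>Pow J1. p U {}) + p {} {}
      = (\<Sum>U\<in>Pow J1 - {{}}. \<Sum>V\<in>Pow J2 - {{}}. p U V)"
    using J rm[of J1 "\<lambda>U. p U {}"] rm[of J2] by (simp add: sum.distrib)
  show ?thesis using main[unfolded m1 m2 m3] unfolding p_def .
qed

section \<open>Size penalties and the coding of a set by its two parts\<close>

definition size_penalty :: "nat \<Rightarrow> real" where
  "size_penalty u = exp (- (480 * (real u * ln (real u))))"

text \<open>Since \<open>3/2 + 1/2 = 2\<close>, the average of \<open>imbalance |U \<inter> A| |U - A|\<close> over all \<open>A \<subseteq> J\<close> is \<open>2\<close>,
  whatever the size of \<open>U\<close>.\<close>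

definition imbalance :: "nat \<Rightarrow> nat \<Rightarrow> real" where
  "imbalance u v = (3 / 2) ^ v * (1 / 2) ^ u + (3 / 2) ^ u * (1 / 2) ^ v"

lemma size_penalty_pos: "0 < size_penalty u"
  by (simp add: size_penalty_def)

lemma size_penalty_Suc_0 [simp]: "size_penalty (Suc 0) = 1"
  by (simp add: size_penalty_def)

lemma imbalance_commute: "imbalance u v = imbalance v u"
  by (simp add: imbalance_def)

lemma imbalance_nonneg: "0 \<le> imbalance u v"
  by (simp add: imbalance_def)

text \<open>For \<open>u \<le> v\<close>, superadditivity of \<open>s ln s\<close> gains
  \<open>u ln ((u + v) / u) \<ge> u / 2\<close>, hence \<open>240 u\<close> after multiplication by
  480. This pays \<open>40 u\<close> and leaves \<open>200 u\<close> towards \<open>40 v\<close>;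
  any remainder \<open>200 (v / 5 - u)\<close> is absorbed by the exponential growth of
  \<open>imbalance\<close>.\<close>

lemma size_penalty_add_le:
  assumes "1 \<le> u" "1 \<le> v"
  shows "size_penalty (u + v)
      \<le> size_penalty u * exp (- (40 * real u)) * (size_penalty v * exp (- (40 * real v))) * exp (200 * imbalance u v)"
  using assms
proof (induction u v rule: linorder_wlog)
  case (le u v)
  have u: "1 \<le> real u" "real u \<le> real v" using le by auto
  have "exp (- (1 / 2)) \<ge> (1 / 2 :: real)" using exp_ge_add_one_self[of "- (1 / 2) :: real"] by simp
  then have "exp (1 / 2) \<le> (2 :: real)" by (simp add: exp_minus field_simps)
  then have "1 / 2 \<le> ln (2 :: real)" by (subst ln_ge_iff) auto
  also have "\<dots> \<le> ln (real (u + v) / real u)" using u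
    by (subst ln_le_cancel_iff) (auto simp: field_simps)
  also have "\<dots> = ln (real (u + v)) - ln (real u)" using u by (simp add: ln_div)
  finally have "real u * (1 / 2) \<le> real u * (ln (real (u + v)) - ln (real u))" using u
    by (intro mult_left_mono) auto
  moreover have "0 \<le> real v * (ln (real (u + v)) - ln (real v))" using u by simp
  ultimately have 1: "real u * ln (real u) + real v * ln (real v) + real u / 2
      \<le> real (u + v) * ln (real (u + v))"
    by (simp add: algebra_simps)
  have "40 * real v - 200 * real u \<le> 200 * exp (real v * (1 / 5) + real u * (- 1))"
    using exp_ge_add_one_self[of "real v * (1 / 5) + real u * (- 1)"] by (simp add: field_simps)
  also have "exp (real v * (1 / 5) + real u * (- 1)) = exp (1 / 5) ^ v * exp (- 1) ^ u"
    by (simp only: exp_add exp_of_nat_mult)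
  also have "\<dots> \<le> (3 / 2) ^ v * (1 / 2) ^ u"
  proof (intro mult_mono power_mono)
    have "4 / 5 \<le> exp (- 1 / 5 :: real)" using exp_ge_add_one_self[of "- 1 / 5 :: real"] by simp
    then show "exp (1 / 5 :: real) \<le> 3 / 2" by (simp add: exp_minus field_simps)
    have "2 \<le> exp (1 :: real)" using exp_ge_add_one_self[of "1 :: real"] by simp
    then show "exp (- 1 :: real) \<le> 1 / 2" by (simp add: exp_minus field_simps)
  qed auto
  also have "\<dots> \<le> imbalance u v" by (simp add: imbalance_def)
  finally have "- (480 * (real (u + v) * ln (real (u + v))))
      \<le> - (480 * (real u * ln (real u))) + (- (40 * real u)) + (- (480 * (real v * ln (real v))) + (- (40 * real v))) + 200 * imbalance u v"
    using 1 by (simp add: algebra_simps)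
  then show ?case
    unfolding size_penalty_def exp_add[symmetric] by simp
next
  case (sym u v)
  then show ?case by (simp add: add.commute mult_ac imbalance_commute)
qed

text \<open>The weight \<open>p\<close> is coded by the product \<open>w1 * w2\<close>. The mismatch
  \<open>p * ln (w1 * w2 / p)\<close> costs at most \<open>w1 * w2\<close>, and the penalties of the
  parts replace that of the union by \<open>size_penalty_add_le\<close>.\<close>

lemma psi_pair_le:
  assumes "1 \<le> u" "1 \<le> v" "0 \<le> p" "p \<le> w1" "p \<le> w2"
  shows "psi (size_penalty (u + v)) p \<le> p * ln (1 + size_penalty u * exp (- (40 * real u)) / w1)
    + p * ln (1 + size_penalty v * exp (- (40 * real v)) / w2) + w1 * w2 + p * (200 * imbalance u v)"
proof (cases "p = 0")
  case True
  then show ?thesis using assms by (simp add: psi_def)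
next
  case False
  then have pos: "0 < p" "0 < w1" "0 < w2" using assms by auto
  define x where "x = size_penalty u * exp (- (40 * real u)) / w1"
  define y where "y = size_penalty v * exp (- (40 * real v)) / w2"
  \<comment> \<open>The maximum with 1 ensures \<open>1 \<le> z * E\<close>, so the summand 1 inside
    the logarithm can be absorbed before factoring.\<close>
  define z where "z = max 1 (w1 * w2 / p)"
  define E where "E = exp (200 * imbalance u v)"
  have xy: "0 < x" "0 < y" using pos by (auto simp: x_def y_def size_penalty_pos)
  have z: "1 \<le> z" by (simp add: z_def)
  have E: "1 \<le> E" by (simp add: E_def imbalance_nonneg)
  have "size_penalty (u + v) / p \<le> (x * w1) * (y * w2) * E / p"
    using size_penalty_add_le[OF assms(1,2)] pos
      by (intro divide_right_mono) (auto simp: x_def y_def E_def)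
  also have "\<dots> = x * y * (w1 * w2 / p) * E" by simp
  also have "\<dots> \<le> x * y * z * E" using xy E
    by (intro mult_right_mono mult_left_mono) (auto simp: z_def)
  finally have "1 + size_penalty (u + v) / p \<le> z * E + x * y * (z * E)"
    using mult_mono[OF z E] z E by simp
  also have "\<dots> \<le> (1 + x) * (1 + y) * (z * E)" using xy z E by (simp add: algebra_simps)
  finally have "ln (1 + size_penalty (u + v) / p) \<le> ln ((1 + x) * (1 + y) * (z * E))"
    using pos xy z E
      by (subst ln_le_cancel_iff) (auto intro!: add_pos_pos mult_pos_pos divide_pos_pos simp: size_penalty_pos)
  also have "\<dots> = ln (1 + x) + ln (1 + y) + ln z + 200 * imbalance u v"
    using xy z by (simp add: ln_mult E_def)
  also have "ln z \<le> w1 * w2 / p"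
    using ln_le_minus_one[of "w1 * w2 / p"] pos by (auto simp: z_def max_def)
  finally have "p * ln (1 + size_penalty (u + v) / p)
      \<le> p * (ln (1 + x) + ln (1 + y) + w1 * w2 / p + 200 * imbalance u v)"
    using pos by (intro mult_left_mono) auto
  then show ?thesis using pos unfolding psi_def x_def[symmetric] y_def[symmetric]
    by (simp add: algebra_simps)
qed

lemma sum_Pow_split_empty:
  fixes g :: "'a set \<Rightarrow> real"
  assumes "finite J"
  shows "(\<Sum>U\<in>Pow J. g U) = g {} + (\<Sum>U\<in>Pow J - {{}}. g U)"
  using assms by (subst sum.remove[where x = "{}"]) auto

text \<open>The free parameter \<open>u\<close> of \<open>avg_psi_walsh_sum_ge\<close> is set to
  \<open>card U\<close>, so its discount is the one that \<open>psi_pair_le\<close>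
  produces.\<close>

lemma sum_psi_restriction_ge:
  fixes a :: "'a set \<Rightarrow> 'a set \<Rightarrow> real"
  assumes J: "finite J1" "finite J2"
  shows "(\<Sum>U\<in>Pow J1 - {{}}. psi (size_penalty (card U)) ((a U {})\<^sup>2))
      + (\<Sum>U\<in>Pow J1 - {{}}. \<Sum>V\<in>Pow J2 - {{}}. (a U V)\<^sup>2 * ln (1 + size_penalty (card U) * exp (- (40 * real (card U))) / (\<Sum>V\<in>Pow J2. (a U V)\<^sup>2)))
    \<le> avg (Pow J2) (\<lambda>Y. \<Sum>U\<in>Pow J1 - {{}}. psi (size_penalty (card U)) ((walsh_sum J2 (a U) Y)\<^sup>2))
      + (\<Sum>U\<in>Pow J1 - {{}}. \<Sum>V\<in>Pow J2 - {{}}. (a U V)\<^sup>2 * (40 + 120 * ((3 / 2) ^ card V * (1 / 2) ^ card U)))"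
proof -
  have "psi (size_penalty (card U)) ((a U {})\<^sup>2)
      + (\<Sum>V\<in>Pow J2 - {{}}. (a U V)\<^sup>2 * ln (1 + size_penalty (card U) * exp (- (40 * real (card U))) / (\<Sum>V\<in>Pow J2. (a U V)\<^sup>2)))
    \<le> avg (Pow J2) (\<lambda>Y. psi (size_penalty (card U)) ((walsh_sum J2 (a U) Y)\<^sup>2))
      + (\<Sum>V\<in>Pow J2 - {{}}. (a U V)\<^sup>2 * (40 + 120 * ((3 / 2) ^ card V * (1 / 2) ^ card U)))" for U
    using avg_psi_walsh_sum_ge[OF J(2) size_penalty_pos, of "card U" "a U" "card U"]
      by (simp add: sum_distrib_right)
  then show ?thesis
    unfolding avg_sum sum.distrib[symmetric] by (intro sum_mono)
qed

text \<open>Sets inside one half keep their own \<open>psi\<close>; sets meeting both halves are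
  coded by the marginals \<open>w1\<close> and \<open>w2\<close>. The resulting logarithms are those
  that \<open>sum_psi_restriction_ge\<close> turns, half by half, into averages over
  restrictions.\<close>

lemma sum_psi_split_le:
  fixes a :: "'a set \<Rightarrow> real"
  assumes J: "finite J1" "finite J2" "J1 \<inter> J2 = {}"
    and F: "\<And>Y. Y \<subseteq> J1 \<union> J2 \<Longrightarrow> walsh_sum (J1 \<union> J2) a Y \<in> {0, 1}"
  shows "(\<Sum>U\<in>Pow (J1 \<union> J2) - {{}}. psi (size_penalty (card U)) ((a U)\<^sup>2))
    \<le> avg (Pow J2) (\<lambda>Y. \<Sum>U\<in>Pow J1 - {{}}. psi (size_penalty (card U)) ((walsh_sum J2 (\<lambda>V. a (U \<union> V)) Y)\<^sup>2))
      + avg (Pow J1) (\<lambda>Y. \<Sum>V\<in>Pow J2 - {{}}. psi (size_penalty (card V)) ((walsh_sum J1 (\<lambda>U. a (U \<union> V)) Y)\<^sup>2))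
      + (\<Sum>U\<in>Pow J1 - {{}}. \<Sum>V\<in>Pow J2 - {{}}. (a (U \<union> V))\<^sup>2 * (83 + 320 * imbalance (card U) (card V)))"
    (is "?L \<le> ?Q1 + ?Q2 + ?E")
proof -
  define N1 where "N1 = Pow J1 - {{}}"
  define N2 where "N2 = Pow J2 - {{}}"
  define p where "p = (\<lambda>U V. (a (U \<union> V))\<^sup>2)"
  define w1 where "w1 = (\<lambda>U. \<Sum>V\<in>Pow J2. p U V)"
  define w2 where "w2 = (\<lambda>V. \<Sum>U\<in>Pow J1. p U V)"
  define l where "l = (\<lambda>u w. ln (1 + size_penalty u * exp (- (40 * real u)) / w))"
  define e where "e = (\<lambda>u v. (3 / 2 :: real) ^ v * (1 / 2) ^ u)"
  have "?L = (\<Sum>U\<in>Pow (J1 \<union> J2). psi (size_penalty (card U)) ((a U)\<^sup>2))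
      - psi (size_penalty 0) ((a {})\<^sup>2)"
    using J sum_Pow_split_empty[of "J1 \<union> J2" "\<lambda>U. psi (size_penalty (card U)) ((a U)\<^sup>2)"] by simp
  also have "\<dots>
      = (\<Sum>V\<in>N2. psi (size_penalty (card V)) ((a V)\<^sup>2)) + (\<Sum>U\<in>N1. psi (size_penalty (card U)) ((a U)\<^sup>2))
      + (\<Sum>U\<in>N1. \<Sum>V\<in>N2. psi (size_penalty (card (U \<union> V))) (p U V))"
    unfolding sum_Pow_Un[OF J(3)]
    using J by (simp add: sum_Pow_split_empty sum.distrib N1_def N2_def p_def)
  also have "(\<Sum>U\<in>N1. \<Sum>V\<in>N2. psi (size_penalty (card (U \<union> V))) (p U V))
    \<le> (\<Sum>U\<in>N1. \<Sum>V\<in>N2. p U V * l (card U) (w1 U) + p U V * l (card V) (w2 V) + w1 U * w2 V + p U V * (200 * imbalance (card U) (card V)))"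
  proof (intro sum_mono)
    fix U V assume UV: "U \<in> N1" "V \<in> N2"
    then have "finite U" "finite V" "U \<inter> V = {}" using J
      by (auto simp: N1_def N2_def intro: finite_subset)
    then have *: "card (U \<union> V) = card U + card V" "1 \<le> card U" "1 \<le> card V"
      using UV by (auto simp: card_Un_disjoint N1_def N2_def Suc_le_eq card_gt_0_iff)
    have "p U V \<le> w1 U"
      unfolding w1_def using UV J by (intro member_le_sum) (simp_all add: p_def N2_def)
    moreover have "p U V \<le> w2 V"
      unfolding w2_def using UV J
        by (intro member_le_sum[of U _ "\<lambda>U. p U V"]) (simp_all add: p_def N1_def)
    ultimately show "psi (size_penalty (card (U \<union> V))) (p U V)
        \<le> p U V * l (card U) (w1 U) + p U V * l (card V) (w2 V) + w1 U * w2 V + p U V * (200 * imbalance (card U) (card V))"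
      unfolding *(1) l_def using *(2,3) by (intro psi_pair_le) (auto simp: p_def)
  qed
  also have "\<dots>
      = (\<Sum>U\<in>N1. \<Sum>V\<in>N2. p U V * l (card U) (w1 U)) + (\<Sum>U\<in>N1. \<Sum>V\<in>N2. p U V * l (card V) (w2 V))
      + (\<Sum>U\<in>N1. w1 U) * (\<Sum>V\<in>N2. w2 V) + (\<Sum>U\<in>N1. \<Sum>V\<in>N2. p U V * (200 * imbalance (card U) (card V)))"
    by (simp add: sum.distrib sum_product)
  \<comment> \<open>Two-valuedness enters here: the total coding mismatch is paid by the weight of
    the sets meeting both halves.\<close>
  also have "(\<Sum>U\<in>N1. w1 U) * (\<Sum>V\<in>N2. w2 V) \<le> (\<Sum>U\<in>N1. \<Sum>V\<in>N2. p U V * 3)"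
    using coeff_product_le_mixed[OF J F] unfolding w1_def w2_def p_def N1_def N2_def
    by (simp add: sum_distrib_left mult.commute)
  finally have 1: "?L
      \<le> (\<Sum>V\<in>N2. psi (size_penalty (card V)) ((a V)\<^sup>2)) + (\<Sum>U\<in>N1. psi (size_penalty (card U)) ((a U)\<^sup>2))
      + (\<Sum>U\<in>N1. \<Sum>V\<in>N2. p U V * l (card U) (w1 U)) + (\<Sum>U\<in>N1. \<Sum>V\<in>N2. p U V * l (card V) (w2 V))
      + (\<Sum>U\<in>N1. \<Sum>V\<in>N2. p U V * 3) + (\<Sum>U\<in>N1. \<Sum>V\<in>N2. p U V * (200 * imbalance (card U) (card V)))"
    by simp
  have 2: "(\<Sum>U\<in>N1. psi (size_penalty (card U)) ((a U)\<^sup>2))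
      + (\<Sum>U\<in>N1. \<Sum>V\<in>N2. p U V * l (card U) (w1 U))
      \<le> ?Q1 + (\<Sum>U\<in>N1. \<Sum>V\<in>N2. p U V * (40 + 120 * e (card U) (card V)))"
    using sum_psi_restriction_ge[OF J(1,2), of "\<lambda>U V. a (U \<union> V)"]
      by (simp add: N1_def N2_def p_def l_def w1_def e_def)
  have 3: "(\<Sum>V\<in>N2. psi (size_penalty (card V)) ((a V)\<^sup>2))
      + (\<Sum>U\<in>N1. \<Sum>V\<in>N2. p U V * l (card V) (w2 V))
      \<le> ?Q2 + (\<Sum>U\<in>N1. \<Sum>V\<in>N2. p U V * (40 + 120 * e (card V) (card U)))"
    unfolding sum.swap[of _ N2 N1]
    using sum_psi_restriction_ge[OF J(2,1), of "\<lambda>V U. a (U \<union> V)"]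
      by (simp add: N1_def N2_def p_def l_def w2_def e_def)
  \<comment> \<open>Collecting constants: \<open>83 = 40 + 40 + 3\<close> and
    \<open>320 = 120 + 200\<close>, the two one-sided exponentials adding up to
    \<open>imbalance\<close>.\<close>
  have "imbalance u v = e u v + e v u" for u v by (simp add: imbalance_def e_def)
  then have "?E
      = (\<Sum>U\<in>N1. \<Sum>V\<in>N2. p U V * (40 + 120 * e (card U) (card V))) + (\<Sum>U\<in>N1. \<Sum>V\<in>N2. p U V * (40 + 120 * e (card V) (card U)))
      + (\<Sum>U\<in>N1. \<Sum>V\<in>N2. p U V * 3) + (\<Sum>U\<in>N1. \<Sum>V\<in>N2. p U V * (200 * imbalance (card U) (card V)))"
    unfolding sum.distrib[symmetric] N1_def N2_def p_def
      by (intro sum.cong refl) (simp add: algebra_simps)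
  with 1 2 3 show ?thesis by linarith
qed

text \<open>The constant \<open>-1600\<close> for non-empty sets is a reserve, released once for each cut:
  \<open>influence_bound u + influence_bound v = influence_bound (u + v) - 1600\<close> for \<open>u, v > 0\<close>.\<close>

definition influence_bound :: "nat \<Rightarrow> real" where
  "influence_bound u = 1604 * real u - (if u = 0 then 0 else 1600)"

text \<open>A bound for the cost \<open>83 + 320 * imbalance u v\<close> of a cut minus the released
  reserve, since \<open>83 + 1280 \<le> 1600\<close>. The 1280 is twice the mean
  \<open>320 * 2\<close>, because only half of all \<open>A\<close> cut a set of size 2.\<close>

definition split_err :: "nat \<Rightarrow> nat \<Rightarrow> real" where
  "split_err u v = (if u = 0 \<or> v = 0 then 0 else 320 * imbalance u v - 1280)"

lemma sum_split_err_nonpos: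
  assumes "finite J" "U \<subseteq> J"
  shows "(\<Sum>A\<in>Pow J. split_err (card (U \<inter> A)) (card (U - A))) \<le> 0"
proof (cases "card U \<le> 1")
  case True
  have "finite U" using assms by (auto intro: finite_subset)
  then have "card U = card (U \<inter> A) + card (U - A)" for A
    using card_Un_disjoint[of "U \<inter> A" "U - A"] by (simp add: Int_Diff_disjoint Int_Diff_Un)
  then have sum: "card (U \<inter> A) + card (U - A) \<le> 1" for A
    using True by metis
  have "card (U \<inter> A) = 0 \<or> card (U - A) = 0" for A
    using sum[of A] by arith
  then show ?thesis by (simp add: split_err_def)
next
  case False
  define m where "m = card U"
  have fin: "finite U" using assms by (auto intro: finite_subset)
  have J: "card J = card (J - U) + m"
    using assms fin by (simp add: m_def card_Diff_subset card_mono)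
  \<comment> \<open>With \<open>0 ^ 0 = 1\<close>, the powers of 0 indicate the \<open>A\<close>
    that leave \<open>U\<close> uncut, where the 1280 must be given back.\<close>
  have "(\<Sum>A\<in>Pow J. split_err (card (U \<inter> A)) (card (U - A)))
    \<le> (\<Sum>A\<in>Pow J. 320 * ((1 / 2) ^ card (U \<inter> A) * (3 / 2) ^ card (U - A)) + 320 * ((3 / 2) ^ card (U \<inter> A) * (1 / 2) ^ card (U - A))
        - 1280 * (1 ^ card (U \<inter> A) * 1 ^ card (U - A)) + 1280 * (1 ^ card (U \<inter> A) * 0 ^ card (U - A)) + 1280 * (0 ^ card (U \<inter> A) * 1 ^ card (U - A)))"
    by (intro sum_mono) (auto simp: split_err_def imbalance_def power_0_left)
  also have "\<dots> = 2 ^ card (J - U) * (640 * 2 ^ m - 1280 * 2 ^ m + 2560)"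
    using assms
      by (simp only: sum.distrib sum_subtractf sum_distrib_left[symmetric] sum_Pow_power_card m_def) (simp add: algebra_simps)
  also have "\<dots> \<le> 0"
  proof (intro mult_nonneg_nonpos)
    have "(2 :: real) ^ 2 \<le> 2 ^ m" using False by (intro power_increasing) (auto simp: m_def)
    then show "640 * 2 ^ m - 1280 * 2 ^ m + 2560 \<le> (0 :: real)" by simp
  qed simp
  finally show ?thesis .
qed

section \<open>Choice of the cut and induction on the coordinate set\<close>

lemma exists_good_split:
  fixes q :: "'a set \<Rightarrow> real"
  assumes J: "finite J" "2 \<le> card J" and q: "\<And>U. 0 \<le> q U"
  obtains A where "A \<subseteq> J" "A \<noteq> {}" "A \<noteq> J"
    "(\<Sum>U\<in>Pow J. q U * split_err (card (U \<inter> A)) (card (U - A))) \<le> 0"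
proof -
  define err where "err = (\<lambda>A. \<Sum>U\<in>Pow J. q U * split_err (card (U \<inter> A)) (card (U - A)))"
  have "(\<Sum>A\<in>Pow J. err A) = (\<Sum>U\<in>Pow J. q U * (\<Sum>A\<in>Pow J. split_err (card (U \<inter> A)) (card (U - A))))"
    unfolding err_def sum_distrib_left by (rule sum.swap)
  also have "\<dots> \<le> 0"
    using J q by (intro sum_nonpos mult_nonneg_nonpos sum_split_err_nonpos) auto
  finally have le: "(\<Sum>A\<in>Pow J. err A) \<le> 0" .
  \<comment> \<open>The trivial cuts have error 0, so the sum over the proper ones is still
    nonpositive and one of them has nonpositive error.\<close>
  have triv: "err {} = 0" "err J = 0"
    unfolding err_def
      by (auto intro!: sum.neutral simp: split_err_def Diff_eq_empty_iff[THEN iffD2])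
  have "(\<Sum>A\<in>Pow J. err A) = (\<Sum>A\<in>Pow J - {{}, J}. err A)"
    using J triv by (intro sum.mono_neutral_right) auto
  with le have le': "(\<Sum>A\<in>Pow J - {{}, J}. err A) \<le> 0" by simp
  have ne: "Pow J - {{}, J} \<noteq> {}"
  proof -
    obtain j where "j \<in> J" using J by (metis card.empty equals0I not_numeral_le_zero)
    then have "{j} \<in> Pow J - {{}, J}" using J by auto
    then show ?thesis by blast
  qed
  have "\<exists>A\<in>Pow J - {{}, J}. err A \<le> 0"
  proof (rule ccontr)
    assume "\<not> ?thesis"
    then have "0 < (\<Sum>A\<in>Pow J - {{}, J}. err A)" using J ne by (intro sum_pos) (auto simp: not_le)
    then show False using le' by simp
  qed
  then show ?thesis using that unfolding err_def by blast
qed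

text \<open>Strong induction on the number of coordinates along a cut of nonpositive weighted error.
  Restrictions of a two-valued function are two-valued, so the hypothesis applies to every
  restriction to either half, and Parseval turns the averaged bounds back into weights of
  \<open>a\<close>.\<close>

lemma sum_psi_le_influence:
  fixes a :: "'a set \<Rightarrow> real"
  assumes "finite J" "\<And>Y. Y \<subseteq> J \<Longrightarrow> walsh_sum J a Y \<in> {0, 1}"
  shows "(\<Sum>U\<in>Pow J - {{}}. psi (size_penalty (card U)) ((a U)\<^sup>2))
      \<le> (\<Sum>U\<in>Pow J. (a U)\<^sup>2 * influence_bound (card U))"
  using assms
proof (induction "card J" arbitrary: J a rule: less_induct)
  case less
  note J = \<open>finite J\<close>
  consider "card J = 0" | "card J = 1" | "2 \<le> card J" by linarith
  then show ?case
  proof cases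
    case 1
    then show ?thesis using J by (simp add: influence_bound_def)
  next
    case 2
    then obtain j where j: "J = {j}" by (auto simp: card_1_singleton_iff)
    have P: "Pow {j} = {{}, {j}}" by auto
    have "a {} + a {j} \<in> {0, 1}" "a {} - a {j} \<in> {0, 1}"
      using less.prems(2)[of "{}"] less.prems(2)[of "{j}"]
        by (auto simp: j P walsh_sum_def walsh_def)
    \<comment> \<open>Two numbers in \<open>{0, 1}\<close> differ by \<open>0\<close> or
      \<open>\<plusminus>1\<close>, which is twice the coefficient. A square of 1/4 gives at most
      \<open>1 / 4 * ln 5 \<le> 1 / 4 * 4\<close>, which explains
      \<open>1604 = 1600 + 4\<close>.\<close>
    then have "a {j} = 0 \<or> a {j} = 1 / 2 \<or> a {j} = - 1 / 2" by auto
    then have "a {j} = 0 \<or> (a {j})\<^sup>2 = 1 / 4" 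
      by (elim disjE; simp only:) (simp_all add: power2_eq_square)
    moreover have "ln (5 :: real) \<le> 4" using ln_le_minus_one[of "5 :: real"] by simp
    moreover have "x * ln (1 + 1 / x) \<le> x * 4" if "x = 1 / 4" for x :: real
      using \<open>ln 5 \<le> 4\<close> unfolding that by simp
    ultimately show ?thesis by (auto simp: j P psi_def influence_bound_def)
  next
    case 3
    obtain A where A: "A \<subseteq> J" "A \<noteq> {}" "A \<noteq> J"
      and err: "(\<Sum>U\<in>Pow J. (a U)\<^sup>2 * split_err (card (U \<inter> A)) (card (U - A))) \<le> 0"
      using exists_good_split[OF J 3, of "\<lambda>U. (a U)\<^sup>2"] by auto
    define B where "B = J - A"
    have AB: "finite A" "finite B" "A \<inter> B = {}" and JAB: "J = A \<union> B"
      using A J by (auto simp: B_def intro: finite_subset)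
    have cA: "card A < card J" and cB: "card B < card J"
      using A J by (auto simp: B_def intro!: psubset_card_mono)
    have F: "walsh_sum (A \<union> B) a Y \<in> {0, 1}" if "Y \<subseteq> A \<union> B" for Y
      using less.prems(2)[of Y] that by (simp add: JAB)
    have Q1: "avg (Pow B) (\<lambda>Z. \<Sum>U\<in>Pow A
        - {{}}. psi (size_penalty (card U)) ((walsh_sum B (\<lambda>V. a (U \<union> V)) Z)\<^sup>2))
        \<le> (\<Sum>U\<in>Pow A. \<Sum>V\<in>Pow B. (a (U \<union> V))\<^sup>2 * influence_bound (card U))"
    proof -
      have "avg (Pow B) (\<lambda>Z. \<Sum>U\<in>Pow A
          - {{}}. psi (size_penalty (card U)) ((walsh_sum B (\<lambda>V. a (U \<union> V)) Z)\<^sup>2))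
          \<le> avg (Pow B) (\<lambda>Z. \<Sum>U\<in>Pow A. (walsh_sum B (\<lambda>V. a (U \<union> V)) Z)\<^sup>2 * influence_bound (card U))"
      proof (intro avg_mono less.hyps cA AB)
        fix Z Y assume "Z \<in> Pow B" "Y \<subseteq> A"
        then have "walsh_sum A (\<lambda>U. walsh_sum B (\<lambda>V. a (U \<union> V)) Z) Y = walsh_sum (A \<union> B) a (Y \<union> Z)"
          using AB by (intro walsh_sum_Un[symmetric]) auto
        also have "\<dots> \<in> {0, 1}" using \<open>Z \<in> Pow B\<close> \<open>Y \<subseteq> A\<close> by (intro F) auto
        finally show "walsh_sum A (\<lambda>U. walsh_sum B (\<lambda>V. a (U \<union> V)) Z) Y \<in> {0, 1}" .
      qed
      also have "\<dots> = (\<Sum>U\<in>Pow A. \<Sum>V\<in>Pow B. (a (U \<union> V))\<^sup>2 * influence_bound (card U))"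
        using AB by (simp add: avg_sum avg_mult_right parseval sum_distrib_right)
      finally show ?thesis .
    qed
    have Q2: "avg (Pow A) (\<lambda>Z. \<Sum>V\<in>Pow B
        - {{}}. psi (size_penalty (card V)) ((walsh_sum A (\<lambda>U. a (U \<union> V)) Z)\<^sup>2))
        \<le> (\<Sum>U\<in>Pow A. \<Sum>V\<in>Pow B. (a (U \<union> V))\<^sup>2 * influence_bound (card V))"
    proof -
      have "avg (Pow A) (\<lambda>Z. \<Sum>V\<in>Pow B
          - {{}}. psi (size_penalty (card V)) ((walsh_sum A (\<lambda>U. a (U \<union> V)) Z)\<^sup>2))
          \<le> avg (Pow A) (\<lambda>Z. \<Sum>V\<in>Pow B. (walsh_sum A (\<lambda>U. a (U \<union> V)) Z)\<^sup>2 * influence_bound (card V))"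
      proof (intro avg_mono less.hyps cB AB)
        fix Z Y assume ZY: "Z \<in> Pow A" "Y \<subseteq> B"
        then have "walsh_sum B (\<lambda>V. walsh_sum A (\<lambda>U. a (U \<union> V)) Z) Y = walsh_sum (A \<union> B) a (Z \<union> Y)"
          using AB walsh_sum_Un[of B A Y Z a] by (simp add: Un_commute Int_commute)
        also have "\<dots> \<in> {0, 1}" using ZY by (intro F) auto
        finally show "walsh_sum B (\<lambda>V. walsh_sum A (\<lambda>U. a (U \<union> V)) Z) Y \<in> {0, 1}" .
      qed
      also have "\<dots> = (\<Sum>V\<in>Pow B. \<Sum>U\<in>Pow A. (a (U \<union> V))\<^sup>2 * influence_bound (card V))"
        using AB by (simp add: avg_sum avg_mult_right parseval sum_distrib_right)
      also have "\<dots> = (\<Sum>U\<in>Pow A. \<Sum>V\<in>Pow B. (a (U \<union> V))\<^sup>2 * influence_bound (card V))"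
        by (rule sum.swap)
      finally show ?thesis .
    qed
    define E where "E = (\<lambda>u v. if u = 0 \<or> v = 0 then 0 else 83 + 320 * imbalance u v)"
    have Q3: "(\<Sum>U\<in>Pow A - {{}}. \<Sum>V\<in>Pow B
        - {{}}. (a (U \<union> V))\<^sup>2 * (83 + 320 * imbalance (card U) (card V)))
        = (\<Sum>U\<in>Pow A. \<Sum>V\<in>Pow B. (a (U \<union> V))\<^sup>2 * E (card U) (card V))"
    proof -
      have "E (card U) (card V) = 83 + 320 * imbalance (card U) (card V)" if "U \<in> Pow A - {{}}"
          "V \<in> Pow B - {{}}" for U V
        using that AB by (auto simp: E_def dest: finite_subset)
      then have "(\<Sum>U\<in>Pow A - {{}}. \<Sum>V\<in>Pow B
          - {{}}. (a (U \<union> V))\<^sup>2 * (83 + 320 * imbalance (card U) (card V)))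
        = (\<Sum>U\<in>Pow A - {{}}. \<Sum>V\<in>Pow B - {{}}. (a (U \<union> V))\<^sup>2 * E (card U) (card V))"
        by (intro sum.cong refl) (simp only:)
      also have "\<dots> = (\<Sum>U\<in>Pow A. \<Sum>V\<in>Pow B. (a (U \<union> V))\<^sup>2 * E (card U) (card V))"
        using AB by (simp add: sum_Pow_split_empty E_def)
      finally show ?thesis .
    qed
    have "(\<Sum>U\<in>Pow J - {{}}. psi (size_penalty (card U)) ((a U)\<^sup>2))
      \<le> (\<Sum>U\<in>Pow A. \<Sum>V\<in>Pow B. (a (U \<union> V))\<^sup>2 * influence_bound (card U)) + (\<Sum>U\<in>Pow A. \<Sum>V\<in>Pow B. (a (U \<union> V))\<^sup>2 * influence_bound (card V))
        + (\<Sum>U\<in>Pow A. \<Sum>V\<in>Pow B. (a (U \<union> V))\<^sup>2 * E (card U) (card V))"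
      unfolding JAB using sum_psi_split_le[OF AB F] Q1 Q2 Q3 by linarith
    also have "\<dots>
        = (\<Sum>U\<in>Pow A. \<Sum>V\<in>Pow B. (a (U \<union> V))\<^sup>2 * (influence_bound (card U) + influence_bound (card V) + E (card U) (card V)))"
      by (simp add: sum.distrib distrib_left)
    also have "\<dots>
        \<le> (\<Sum>U\<in>Pow A. \<Sum>V\<in>Pow B. (a (U \<union> V))\<^sup>2 * (influence_bound (card (U \<union> V)) + split_err (card ((U \<union> V) \<inter> A)) (card ((U \<union> V) - A))))"
    proof (intro sum_mono mult_left_mono)
      \<comment> \<open>If both parts are non-empty, one reserve is released and
        \<open>83 - 1600 \<le> -1280\<close>; for an uncut set the two sides agree.\<close>
      fix U V assume UV: "U \<in> Pow A" "V \<in> Pow B"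
      then have "(U \<union> V) \<inter> A = U" "(U \<union> V) - A = V" "U \<inter> V = {}" using AB by auto
      moreover have "finite U" "finite V" using UV AB by (auto intro: finite_subset)
      ultimately show "influence_bound (card U) + influence_bound (card V) + E (card U) (card V)
          \<le> influence_bound (card (U \<union> V)) + split_err (card ((U \<union> V) \<inter> A)) (card ((U \<union> V) - A))"
        by (simp add: card_Un_disjoint influence_bound_def split_err_def E_def)
    qed simp
    also have "\<dots>
        = (\<Sum>U\<in>Pow J. (a U)\<^sup>2 * (influence_bound (card U) + split_err (card (U \<inter> A)) (card (U - A))))"
      unfolding JAB by (rule sum_Pow_Un[symmetric]) (rule AB)
    also have "\<dots>
        = (\<Sum>U\<in>Pow J. (a U)\<^sup>2 * influence_bound (card U)) + (\<Sum>U\<in>Pow J. (a U)\<^sup>2 * split_err (card (U \<inter> A)) (card (U - A)))"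
      by (simp add: sum.distrib distrib_left)
    finally show ?thesis using err by linarith
  qed
qed

section \<open>Fourier coefficients on the cube\<close>

text \<open>Toggling a coordinate on which \<open>Y\<close> and \<open>Z\<close> differ flips the
  sign of the summand.\<close>

lemma sum_walsh_mult:
  assumes "finite J" "Y \<subseteq> J" "Z \<subseteq> J"
  shows "(\<Sum>U\<in>Pow J. walsh U Y * walsh U Z) = (if Y = Z then 2 ^ card J else 0)"
proof (cases "Y = Z")
  case True
  have "walsh U Z * walsh U Z = 1" for U
    by (simp add: walsh_def minus_one_power_iff)
  then show ?thesis using True assms by (simp add: card_Pow)
next
  case False
  then obtain i where i: "i \<in> Y \<union> Z" "i \<notin> Y \<or> i \<notin> Z" by blast
  define J' where "J' = J - {i}"
  have J': "J = insert i J'" "finite J'" "i \<notin> J'" using i assms by (auto simp: J'_def)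
  have "walsh (insert i U) Y * walsh (insert i U) Z
      = - (walsh U Y * walsh U Z)" if "U \<in> Pow J'" for U
  proof -
    have "finite U" "i \<notin> U" using that J' by (auto intro: finite_subset)
    then have "walsh (insert i U) W = (if i \<in> W then - walsh U W else walsh U W)" for W
      by (simp add: walsh_def)
    then show ?thesis using i by auto
  qed
  then show ?thesis
    using False J' by (simp add: J'(1) sum_Pow_insert sum_negf cong: sum.cong_simp)
qed

text \<open>Fourier inversion: orthogonality in the index \<open>U\<close> keeps only the point
  \<open>Z = Y\<close>.\<close>

lemma walsh_sum_avg_walsh:
  assumes "finite J" "Y \<subseteq> J"
  shows "walsh_sum J (\<lambda>U. avg (Pow J) (\<lambda>Z. F Z * walsh U Z)) Y = F Y"
proof -
  have "walsh_sum J (\<lambda>U. avg (Pow J) (\<lambda>Z. F Z * walsh U Z)) Y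
      = avg (Pow J) (\<lambda>Z. F Z * (\<Sum>U\<in>Pow J. walsh U Z * walsh U Y))"
    by (simp add: walsh_sum_def avg_sum[symmetric] avg_mult_right[symmetric] sum_distrib_left mult.assoc)
  also have "\<dots> = avg (Pow J) (\<lambda>Z. if Y = Z then F Y * 2 ^ card J else 0)"
    using assms by (intro avg_cong) (auto simp: sum_walsh_mult)
  also have "\<dots> = F Y"
    using assms by (simp add: avg_def card_Pow)
  finally show ?thesis .
qed

lemma avg_walsh_mult:
  assumes "finite J" "U \<subseteq> J" "V \<subseteq> J"
  shows "avg (Pow J) (\<lambda>Y. walsh U Y * walsh V Y) = (if U = V then 1 else 0)"
  using sum_walsh_mult[OF assms] assms
    by (simp add: avg_def card_Pow walsh_commute[of U] walsh_commute[of V])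

section \<open>Translation between subsets and points of the cube\<close>

definition cube_point :: "nat \<Rightarrow> nat set \<Rightarrow> nat \<Rightarrow> nat" where
  "cube_point n Y = (\<lambda>i\<in>{1..n}. if i \<in> Y then 1 else 0)"

lemma bij_betw_cube_point: "bij_betw (cube_point n) (Pow {1..n}) (cube n)"
proof (rule bij_betwI[where g = "\<lambda>x. {i \<in> {1..n}. x i = 1}"])
  show "cube_point n \<in> Pow {1..n} \<rightarrow> cube n"
    by (auto simp: cube_point_def cube_def)
  show "(\<lambda>x. {i \<in> {1..n}. x i = 1}) \<in> cube n \<rightarrow> Pow {1..n}" by auto
  show "{i \<in> {1..n}. cube_point n Y i = 1} = Y" if "Y \<in> Pow {1..n}" for Y
    using that by (auto simp: cube_point_def)
  show "cube_point n {i \<in> {1..n}. x i = 1} = x" if "x \<in> cube n" for x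
  proof
    fix i
    show "cube_point n {i \<in> {1..n}. x i = 1} i = x i"
    proof (cases "i \<in> {1..n}")
      case True
      then have "x i \<in> {0, 1}" using that unfolding cube_def by (rule PiE_mem[rotated])
      then show ?thesis using True by (auto simp: cube_point_def)
    next
      case False
      then show ?thesis using PiE_arb[OF that[unfolded cube_def] False]
        by (simp only: cube_point_def restrict_apply if_False)
    qed
  qed
qed

lemma chi_cube_point:
  assumes "S \<subseteq> {1..n}"
  shows "chi S (cube_point n Y) = walsh S Y"
proof -
  have fin: "finite S" using assms by (rule finite_subset) simp
  have "(\<Sum>i\<in>S. cube_point n Y i) = (\<Sum>i\<in>S. if i \<in> Y then 1 else 0)"
    using assms by (intro sum.cong) (auto simp: cube_point_def)
  also have "\<dots> = card (S \<inter> Y)"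
    using fin by (simp add: sum.If_cases)
  finally show ?thesis by (simp add: chi_def walsh_def)
qed

lemma fourier_coeff_eq_avg:
  assumes "S \<subseteq> {1..n}"
  shows "fourier_coeff n f S = avg (Pow {1..n}) (\<lambda>Y. f (cube_point n Y) * walsh S Y)"
  using sum.reindex_bij_betw[OF bij_betw_cube_point, of "\<lambda>x. f x
      * chi S x" n] bij_betw_same_card[OF bij_betw_cube_point, of n]
  by (simp add: fourier_coeff_def avg_def chi_cube_point[OF assms])

lemma fourier_coeff_low_degree_part:
  assumes "S \<subseteq> {1..n}"
  shows "fourier_coeff n (low_degree_part n D f) S
      = (if card S \<le> D then fourier_coeff n f S else 0)"
proof -
  define L where "L = {T. T \<subseteq> {1..n} \<and> card T \<le> D}"
  have fin: "finite L" by (rule finite_subset[of _ "Pow {1..n}"]) (auto simp: L_def)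
  have "fourier_coeff n (low_degree_part n D f) S
      = avg (Pow {1..n}) (\<lambda>Y. \<Sum>T\<in>L. fourier_coeff n f T * (walsh T Y * walsh S Y))"
    unfolding fourier_coeff_eq_avg[OF assms] low_degree_part_def L_def[symmetric]
    by (intro avg_cong) (simp add: sum_distrib_right L_def chi_cube_point mult.assoc)
  also have "\<dots> = (\<Sum>T\<in>L. fourier_coeff n f T * avg (Pow {1..n}) (\<lambda>Y. walsh T Y * walsh S Y))"
    by (simp add: avg_sum avg_mult_left)
  also have "\<dots> = (\<Sum>T\<in>L. if T = S then fourier_coeff n f S else 0)"
    using assms by (intro sum.cong) (auto simp: L_def avg_walsh_mult)
  also have "\<dots> = (if card S \<le> D then fourier_coeff n f S else 0)"
    using assms fin by (simp add: L_def)
  finally show ?thesis .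
qed

lemma fourier_entropy_low_degree_part:
  "fourier_entropy n (low_degree_part n D f)
    = (\<Sum>S | S \<subseteq> {1..n} \<and> card S \<le> D. (fourier_coeff n f S)\<^sup>2 * ln (1 / (fourier_coeff n f S)\<^sup>2))"
proof -
  have "fourier_entropy n (low_degree_part n D f)
      = (\<Sum>S | S \<subseteq> {1..n}. if card S \<le> D then (fourier_coeff n f S)\<^sup>2 * ln (1 / (fourier_coeff n f S)\<^sup>2) else 0)"
    unfolding fourier_entropy_def by (intro sum.cong refl) (simp add: fourier_coeff_low_degree_part)
  also have "\<dots>
      = (\<Sum>S | S \<subseteq> {1..n} \<and> card S \<le> D. (fourier_coeff n f S)\<^sup>2 * ln (1 / (fourier_coeff n f S)\<^sup>2))"
    using sum.inter_filter[of "{S. S \<subseteq> {1..n}}"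
        "\<lambda>S. (fourier_coeff n f S)\<^sup>2 * ln (1 / (fourier_coeff n f S)\<^sup>2)" "\<lambda>S. card S \<le> D"]
    by simp
  finally show ?thesis .
qed

section \<open>From the bound on \<open>psi\<close> to the entropy inequality\<close>

lemma psi_nonneg: "0 < c \<Longrightarrow> 0 \<le> x \<Longrightarrow> 0 \<le> psi c x"
  by (simp add: psi_def)

text \<open>Dividing by the penalty inside the logarithm costs \<open>480 * s * ln s\<close>, the
  source of the \<open>|S| log (|S| + 1)\<close> term; adding 1 to the argument only increases the
  logarithm.\<close>

lemma mult_ln_inverse_le_psi:
  assumes "0 \<le> x"
  shows "x * ln (1 / x) \<le> psi (size_penalty s) x + 480 * (real s * ln (real s + 1) * x)"
proof (cases "x = 0")
  case False
  then have x: "0 < x" using assms by simp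
  have "real s * ln (real s) \<le> real s * ln (real s + 1)"
    by (cases "s = 0") (auto intro!: mult_left_mono)
  then have "ln (1 / x) \<le> ln (size_penalty s / x) + 480 * (real s * ln (real s + 1))"
    using x size_penalty_pos[of s] by (simp add: ln_div size_penalty_def)
  also have "ln (size_penalty s / x) \<le> ln (1 + size_penalty s / x)"
    using x size_penalty_pos[of s] by (subst ln_le_cancel_iff) (auto intro: add_pos_pos)
  finally have "x * ln (1 / x)
      \<le> x * (ln (1 + size_penalty s / x) + 480 * (real s * ln (real s + 1)))"
    using x by (intro mult_left_mono) auto
  then show ?thesis by (simp add: psi_def algebra_simps)
qed (simp add: psi_def)

theorem theorem1p3:
  "\<exists>K::real. K > 0 \<and>
    (\<forall>(n::nat) (D::nat) (f :: (nat \<Rightarrow> nat) \<Rightarrow> real). f \<in> cube n \<rightarrow> {0, 1} \<longrightarrow>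
      fourier_entropy n (low_degree_part n D f)
        \<le> K * (\<Sum>S | S \<subseteq> {1..n} \<and> card S \<le> D.
                 real (card S) * ln (real (card S) + 1) * (fourier_coeff n f S)\<^sup>2)
          + K * total_influence n f)"
\<comment> \<open>1604 comes from the non-empty sets and 2 from the empty set; the main sum needs
  only 480.\<close>
proof (intro exI[of _ 1606] conjI allI impI)
  show "(0 :: real) < 1606" by simp
next
  fix n D :: nat and f :: "(nat \<Rightarrow> nat) \<Rightarrow> real"
  assume f: "f \<in> cube n \<rightarrow> {0, 1}"
  define J where "J = {1..n}"
  define a where "a = fourier_coeff n f"
  define L where "L = {S. S \<subseteq> J \<and> card S \<le> D}"
  define I where "I = total_influence n f"
  define F where "F = (\<lambda>Y. f (cube_point n Y))"
  have J: "finite J" by (simp add: J_def)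
  have I: "I = (\<Sum>S\<in>Pow J. real (card S) * (a S)\<^sup>2)"
    unfolding I_def total_influence_def a_def J_def by (rule sum.cong) auto
  have F01: "F Y \<in> {0, 1}" if "Y \<subseteq> J" for Y
    using f that bij_betw_apply[OF bij_betw_cube_point, of Y n] unfolding F_def J_def by auto
  have F: "walsh_sum J a Y = F Y" if "Y \<subseteq> J" for Y
  proof -
    have "walsh_sum J a Y = walsh_sum J (\<lambda>U. avg (Pow J) (\<lambda>Z. F Z * walsh U Z)) Y"
      unfolding walsh_sum_def
        by (intro sum.cong) (auto simp: a_def J_def F_def fourier_coeff_eq_avg)
    then show ?thesis using J that by (simp add: walsh_sum_avg_walsh)
  qed
  define \<mu> where "\<mu> = a {}"
  have \<mu>_avg: "\<mu> = avg (Pow J) F"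
    by (simp add: \<mu>_def a_def J_def F_def fourier_coeff_eq_avg)
  \<comment> \<open>A function with values 0 and 1 equals its square, so the total Fourier weight is
    the mean.\<close>
  have "(\<Sum>S\<in>Pow J. (a S)\<^sup>2) = avg (Pow J) (\<lambda>Y. (F Y)\<^sup>2)"
    using parseval[OF J, of a] F by (simp cong: avg_cong_simp)
  also have "\<dots> = \<mu>"
    unfolding \<mu>_avg
  proof (intro avg_cong)
    fix Y assume "Y \<in> Pow J"
    then have "F Y = 0 \<or> F Y = 1" using F01[of Y] by blast
    then show "(F Y)\<^sup>2 = F Y" by (elim disjE) simp_all
  qed
  finally have sum_sq: "(\<Sum>S\<in>Pow J - {{}}. (a S)\<^sup>2) = \<mu> - \<mu>\<^sup>2"
    using sum_Pow_split_empty[OF J, of "\<lambda>S. (a S)\<^sup>2"] by (simp add: \<mu>_def)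
  \<comment> \<open>Poincare's inequality: the variance is the weight of the non-empty sets, each of
    size at least 1.\<close>
  have "\<mu> - \<mu>\<^sup>2 \<le> (\<Sum>S\<in>Pow J - {{}}. real (card S) * (a S)\<^sup>2)"
    unfolding sum_sq[symmetric]
  proof (intro sum_mono)
    fix S assume "S \<in> Pow J - {{}}"
    then have "1 \<le> real (card S)" using J
      by (auto simp: Suc_le_eq card_gt_0_iff dest: finite_subset)
    then show "(a S)\<^sup>2 \<le> real (card S) * (a S)\<^sup>2"
      using mult_right_mono[of 1 "real (card S)" "(a S)\<^sup>2"] by simp
  qed
  also have "\<dots> = I" unfolding I using sum_Pow_split_empty[OF J, of "\<lambda>S. real (card S) * (a S)\<^sup>2"]
    by simp
  finally have var: "\<mu> - \<mu>\<^sup>2 \<le> I" .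
  have "0 \<le> \<mu>" unfolding \<mu>_avg
  proof (intro avg_nonneg)
    fix Y assume "Y \<in> Pow J"
    then have "F Y = 0 \<or> F Y = 1" using F01[of Y] by blast
    then show "0 \<le> F Y" by (elim disjE) simp_all
  qed
  \<comment> \<open>The empty set contributes nothing to the right-hand side, so its entropy is
    charged to the variance by \<open>ln y \<le> y - 1\<close> at
    \<open>y = 1 / \<mu>\<close>.\<close>
  have mean: "(a {})\<^sup>2 * ln (1 / (a {})\<^sup>2) \<le> 2 * I"
  proof (cases "\<mu> = 0")
    case True
    then show ?thesis using var by (simp add: \<mu>_def)
  next
    case False
    then have \<mu>: "0 < \<mu>" using \<open>0 \<le> \<mu>\<close> by simp
    have "ln (1 / \<mu>\<^sup>2) = 2 * ln (1 / \<mu>)" using \<mu> by (simp add: ln_div ln_realpow)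
    also have "\<dots> \<le> 2 * (1 / \<mu> - 1)" using \<mu> by (intro mult_left_mono ln_le_minus_one) auto
    finally have "\<mu>\<^sup>2 * ln (1 / \<mu>\<^sup>2) \<le> \<mu>\<^sup>2 * (2 * (1 / \<mu> - 1))" by (intro mult_left_mono) auto
    also have "\<dots> = 2 * (\<mu> - \<mu>\<^sup>2)" using \<mu> by (simp add: power2_eq_square algebra_simps)
    finally show ?thesis using var by (simp add: \<mu>_def)
  qed
  have "(\<Sum>S\<in>Pow J - {{}}. psi (size_penalty (card S)) ((a S)\<^sup>2))
      \<le> (\<Sum>S\<in>Pow J. (a S)\<^sup>2 * influence_bound (card S))"
    using J F F01 by (intro sum_psi_le_influence) auto
  also have "\<dots> \<le> (\<Sum>S\<in>Pow J. 1604 * (real (card S) * (a S)\<^sup>2))"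
  proof (intro sum_mono)
    fix S
    have "(a S)\<^sup>2 * influence_bound (card S) \<le> (a S)\<^sup>2 * (1604 * real (card S))"
      by (intro mult_left_mono) (auto simp: influence_bound_def)
    then show "(a S)\<^sup>2 * influence_bound (card S) \<le> 1604 * (real (card S) * (a S)\<^sup>2)"
      by (simp add: mult_ac)
  qed
  also have "\<dots> = 1604 * I" by (simp add: I sum_distrib_left)
  finally have psi_sum: "(\<Sum>S\<in>Pow J - {{}}. psi (size_penalty (card S)) ((a S)\<^sup>2)) \<le> 1604 * I" .
  have L: "finite L" "L - {{}} \<subseteq> Pow J - {{}}" "{} \<in> L"
    using J by (auto simp: L_def intro: finite_subset[of _ "Pow J"])
  have "fourier_entropy n (low_degree_part n D f) = (\<Sum>S\<in>L. (a S)\<^sup>2 * ln (1 / (a S)\<^sup>2))"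
    by (simp add: fourier_entropy_low_degree_part L_def J_def a_def)
  also have "\<dots> = (a {})\<^sup>2 * ln (1 / (a {})\<^sup>2) + (\<Sum>S\<in>L - {{}}. (a S)\<^sup>2 * ln (1 / (a S)\<^sup>2))"
    using L by (subst sum.remove[where x = "{}"]) auto
  also have "(\<Sum>S\<in>L - {{}}. (a S)\<^sup>2 * ln (1 / (a S)\<^sup>2))
      \<le> (\<Sum>S\<in>L - {{}}. psi (size_penalty (card S)) ((a S)\<^sup>2) + 480 * (real (card S) * ln (real (card S) + 1) * (a S)\<^sup>2))"
    by (intro sum_mono mult_ln_inverse_le_psi) auto
  also have "\<dots>
      = (\<Sum>S\<in>L - {{}}. psi (size_penalty (card S)) ((a S)\<^sup>2)) + 480 * (\<Sum>S\<in>L - {{}}. real (card S) * ln (real (card S) + 1) * (a S)\<^sup>2)"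
    by (simp add: sum.distrib sum_distrib_left)
  \<comment> \<open>Nonnegativity of \<open>psi\<close> allows the sum to be extended beyond degree
    \<open>D\<close>, so the resulting bound is uniform in \<open>D\<close>.\<close>
  also have "(\<Sum>S\<in>L - {{}}. psi (size_penalty (card S)) ((a S)\<^sup>2))
      \<le> (\<Sum>S\<in>Pow J - {{}}. psi (size_penalty (card S)) ((a S)\<^sup>2))"
    using J L by (intro sum_mono2) (auto intro: psi_nonneg size_penalty_pos)
  also have "\<dots> \<le> 1604 * I" by (rule psi_sum)
  also have "(\<Sum>S\<in>L - {{}}. real (card S) * ln (real (card S) + 1) * (a S)\<^sup>2)
      = (\<Sum>S\<in>L. real (card S) * ln (real (card S) + 1) * (a S)\<^sup>2)"
    using L by (subst (2) sum.remove[where x = "{}"]) auto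
  also note mean
  finally have "fourier_entropy n (low_degree_part n D f)
      \<le> 480 * (\<Sum>S\<in>L. real (card S) * ln (real (card S) + 1) * (a S)\<^sup>2) + 1606 * I"
    by simp
  also have "480 * (\<Sum>S\<in>L. real (card S) * ln (real (card S) + 1) * (a S)\<^sup>2)
      \<le> 1606 * (\<Sum>S\<in>L. real (card S) * ln (real (card S) + 1) * (a S)\<^sup>2)"
    by (intro mult_right_mono sum_nonneg) auto
  finally show "fourier_entropy n (low_degree_part n D f)
        \<le> 1606 * (\<Sum>S | S \<subseteq> {1..n} \<and> card S \<le> D.
                 real (card S) * ln (real (card S) + 1) * (fourier_coeff n f S)\<^sup>2)
          + 1606 * total_influence n f"
    by (simp add: L_def J_def a_def I_def)
qed

end
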